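(* Let $n$ and $k$ be integers with $3\le k\le n-2$. Among all trees on $n$ vertices with exactly $k$ pendent vertices, $BS_{n,k}$ is the unique tree having maximal Harary index.
   Context: A pendent vertex is a vertex of degree $1$. The Harary index of a connected graph $G$ is $H(G)=\sum_{\{x,y\}\subseteq V(G),\,x\ne y}\frac{1}{d(x,y)}$, $d$ the shortest-path distance. $BS_{n,k}$ is the balanced starlike tree: the tree on $n$ vertices consisting of a vertex $v$ such that removing $v$ leaves $k$ disjoint paths with $n_1,\dots,n_k$ vertices ($n_1+\dots+n_k=n-1$, $|n_i-n_j|\le 1$ for all $i,j$), $v$ being adjacent to an endvertex of each path. *)

theory Defs
  imports "Graph_Theory.Graph_Theory"
begin

text \<open>
  Finite simple graphs are the symmetric loop-free digraphs of \<^locale>\<open>pair_graph\<close>: an undirected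
  edge is the pair of its two opposite arcs, so the degree of a vertex is its out-degree.
\<close>

definition simple_graph_tree :: "'a pair_pre_digraph \<Rightarrow> bool" where
  \<comment> \<open>A back-and-forth walk along one edge counts as a \<^const>\<open>pre_digraph.cycle\<close> of length 2 in a
     symmetric digraph, so the library's acyclicity notion is unusable here; the cycles of the
     undirected graph are those of length at least 3.\<close>
  "simple_graph_tree G \<longleftrightarrow> pair_graph G \<and> Digraph_Component.connected (with_proj G) \<and>
     \<not> (\<exists>p. pre_digraph.cycle (with_proj G) p \<and> 3 \<le> length p)"

definition pendent_vertices :: "'a pair_pre_digraph \<Rightarrow> 'a set" where
  "pendent_vertices G = {v \<in> pverts G. out_degree (with_proj G) v = 1}"

definition graph_dist :: "'a pair_pre_digraph \<Rightarrow> 'a \<Rightarrow> 'a \<Rightarrow> real" where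
  "graph_dist G x y = real_of_ereal (wf_digraph.\<mu> (with_proj G) (\<lambda>_. 1) x y)"

lemma graph_dist_commute:
  assumes "pair_graph G"
  shows "graph_dist G x y = graph_dist G y x"
proof -
  interpret pair_graph G by (rule assms)
  have cost: "awalk_cost (\<lambda>_. 1) p = real (length p)" for p :: "('a \<times> 'a) list"
    by (induction p) simp_all
  have len: "length (rev_path p) = length p" for p :: "('a \<times> 'a) list"
    by (induction p) auto
  have "\<mu> (\<lambda>_. 1) u v \<le> \<mu> (\<lambda>_. 1) v u" for u v
    unfolding \<mu>_def
  proof (rule INF_mono)
    fix p assume "p \<in> {p. awalk v p u}"
    then have "rev_path p \<in> {p. awalk u p v}"
      by simp
    then show "\<exists>q\<in>{p. awalk u p v}.
        ereal (awalk_cost (\<lambda>_. 1) q) \<le> ereal (awalk_cost (\<lambda>_. 1) p)"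
      by (intro bexI[of _ "rev_path p"]) (simp_all add: cost len)
  qed
  then have "\<mu> (\<lambda>_. 1) x y = \<mu> (\<lambda>_. 1) y x"
    by (intro antisym)
  then show ?thesis
    by (simp add: graph_dist_def)
qed

definition harary_index :: "'a pair_pre_digraph \<Rightarrow> real" where
  \<comment> \<open>Every unordered pair of distinct vertices occurs as two ordered pairs with the same distance
     (lemma \<open>graph_dist_commute\<close>), hence the division by 2.\<close>
  "harary_index G =
     (\<Sum>(x, y) \<in> {(x, y). x \<in> pverts G \<and> y \<in> pverts G \<and> x \<noteq> y}. 1 / graph_dist G x y) / 2"

definition balanced_starlike :: "nat \<Rightarrow> nat \<Rightarrow> 'a pair_pre_digraph \<Rightarrow> bool" where
  \<comment> \<open>\<open>v\<close> is the centre and \<open>ps\<close> lists the vertex sequences of the \<open>k\<close> paths that remain when \<open>v\<close> is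
     removed, each starting at the endvertex adjacent to \<open>v\<close>; \<open>vwalk_arcs (v # p)\<close> are the arcs
     between consecutive vertices of \<open>v # p\<close>.\<close>
  "balanced_starlike n k G \<longleftrightarrow> (\<exists>v ps.
     length ps = k \<and> [] \<notin> set ps \<and> distinct (v # concat ps) \<and>
     sum_list (map length ps) + 1 = n \<and>
     (\<forall>p \<in> set ps. \<forall>q \<in> set ps. length p \<le> length q + 1) \<and>
     pverts G = set (v # concat ps) \<and>
     parcs G = (\<Union>p \<in> set ps. (set (vwalk_arcs (v # p)))\<^sup>s))"

end

theory Submission
  imports Defs
begin

text \<open>
  Cut a pendant path of \<open>l\<close> vertices off a tree \<open>T\<close> at the nearest branching vertex \<open>v\<close>. The rest \<open>T'\<close>
  is a tree with one leaf less, and \<open>H T - H T'\<close> depends only on \<open>l\<close> and on how many vertices of \<open>T'\<close>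
  lie at each distance from \<open>v\<close>. No level of \<open>T'\<close> around \<open>v\<close> has more vertices than \<open>T'\<close> has leaves,
  so this difference is largest when the levels are filled greedily, as around the centre of a
  balanced starlike tree. By induction \<open>H T\<close> is at most the Harary index of the starlike tree with one
  leg of length \<open>l\<close> and the others balanced, and moving a vertex from a longer leg to a shorter one
  increases the index. In the case of equality the first level around \<open>v\<close> is full, so \<open>v\<close> has as many
  neighbours as \<open>T\<close> has leaves, which makes \<open>T\<close> starlike.
\<close>

section \<open>Harary indices of starlike trees\<close>

text \<open>Cutting off a single leaf would not do: around a neighbour of degree 2, the levels of a
  starlike tree with three or more legs are not filled greedily, so the estimate would not be sharp.
  Cutting back to a branching vertex lowers the number of leaves by exactly one and leaves
  \<open>v\<close> in the role of the centre. The starlike tree reached in the induction step has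
  one prescribed leg and is in general not balanced, which calls for a separate exchange argument on
  lists of leg lengths. Its strict form needs a third nonempty leg, because two legs form the same
  path however it is divided between them; hence the equality case is treated for at least three
  leaves. Subtrees are represented by restricting one distance function to a smaller vertex set:
  removing a pendant path changes no distance between the remaining vertices.\<close>

definition balanced :: "nat list \<Rightarrow> bool" where
  "balanced bs \<longleftrightarrow> (\<forall>a\<in>set bs. \<forall>b\<in>set bs. a \<le> b + 1)"

text \<open>What a path of \<open>l\<close> vertices contributes to a vertex at distance
  \<open>t\<close> from its attachment vertex; a difference of two harmonic numbers.\<close>

definition inv_sum :: "nat \<Rightarrow> nat \<Rightarrow> real" where
  "inv_sum l t = (\<Sum>i<l. 1 / real (t + i + 1))"

text \<open>The Harary index of the path with \<open>l\<close> edges, that is, of a leg of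
  \<open>l\<close> vertices together with the centre.\<close>

definition path_harary :: "nat \<Rightarrow> real" where
  "path_harary l = (\<Sum>i<l. inv_sum (Suc i) 0)"

text \<open>The pairs between two legs of \<open>l\<close> and \<open>m\<close> vertices; summand
  \<open>j\<close> belongs to the vertex at distance \<open>Suc j\<close> from the centre.\<close>

definition leg_pair :: "nat \<Rightarrow> nat \<Rightarrow> real" where
  "leg_pair l m = (\<Sum>j<m. inv_sum l (Suc j))"

text \<open>The Harary index of the starlike tree with these leg lengths, as
  \<open>harary_spider\<close> shows.\<close>

fun spider_harary :: "nat list \<Rightarrow> real" where
  "spider_harary [] = 0"
| "spider_harary (l # ls) = spider_harary ls + path_harary l + (\<Sum>m\<leftarrow>ls. leg_pair l m)"

lemma inv_sum_0 [simp]: "inv_sum 0 t = 0"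
  by (simp add: inv_sum_def)

lemma inv_sum_Suc: "inv_sum (Suc l) t = inv_sum l t + 1 / real (t + l + 1)"
  by (simp add: inv_sum_def)

lemma inv_sum_split: "inv_sum (l + m) t = inv_sum l t + inv_sum m (t + l)"
  by (induction m) (simp_all add: inv_sum_Suc algebra_simps)

lemma inv_sum_strict_antimono:
  assumes "0 < l" "s < t"
  shows "inv_sum l t < inv_sum l s"
  unfolding inv_sum_def using assms
  by (intro sum_strict_mono) (auto simp: frac_less2)

lemma leg_pair_double: "leg_pair l m = (\<Sum>i<l. \<Sum>j<m. 1 / real (i + j + 2))"
proof -
  have "leg_pair l m = (\<Sum>j<m. \<Sum>i<l. 1 / real (i + j + 2))"
    unfolding leg_pair_def inv_sum_def by (intro sum.cong refl) (simp add: algebra_simps)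
  then show ?thesis
    by (subst sum.swap) simp
qed

lemma leg_pair_commute: "leg_pair l m = leg_pair m l"
  unfolding leg_pair_double by (subst sum.swap) (simp add: add.commute)

lemma leg_pair_Suc_left: "leg_pair (Suc l) m = leg_pair l m + inv_sum m (Suc l)"
  by (subst (1 2) leg_pair_commute) (simp add: leg_pair_def)

lemma path_harary_0 [simp]: "path_harary 0 = 0"
  by (simp add: path_harary_def)

lemma path_harary_Suc: "path_harary (Suc l) = path_harary l + inv_sum (Suc l) 0"
  by (simp add: path_harary_def)

lemma path_harary_conv: "path_harary l = (\<Sum>i<l. inv_sum i 0) + inv_sum l 0"
  by (induction l) (simp_all add: path_harary_Suc)

lemma leg_pair_0 [simp]: "leg_pair l 0 = 0" "leg_pair 0 l = 0"
  by (simp_all add: leg_pair_def)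

text \<open>Two legs and their common centre form a single path with \<open>p + q\<close>
  edges.\<close>

lemma path_harary_add: "path_harary (p + q) = path_harary p + path_harary q + leg_pair p q"
proof (induction p)
  case (Suc p)
  have "inv_sum (Suc (p + q)) 0 = inv_sum (Suc p) 0 + inv_sum q (Suc p)"
    using inv_sum_split[of "Suc p" q 0] by simp
  then show ?case
    using Suc by (simp add: path_harary_Suc leg_pair_Suc_left)
qed simp

text \<open>The recursion visits each pair of legs once, in list order. The full double sum,
  corrected on the diagonal, is visibly invariant under permutations.\<close>

lemma spider_harary_symmetric_form:
  "2 * spider_harary ls =
     (\<Sum>l\<leftarrow>ls. 2 * path_harary l - leg_pair l l) + (\<Sum>l\<leftarrow>ls. \<Sum>m\<leftarrow>ls. leg_pair l m)"
proof (induction ls)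
  case (Cons l ls)
  have "(\<Sum>x\<leftarrow>ls. leg_pair x l) = (\<Sum>m\<leftarrow>ls. leg_pair l m)"
    by (simp add: leg_pair_commute)
  then show ?case
    using Cons by (simp add: sum_list_addf)
qed simp

lemma spider_harary_cong_mset:
  assumes "mset ls = mset ms"
  shows "spider_harary ls = spider_harary ms"
proof -
  have sum_eq: "(\<Sum>l\<leftarrow>ls. f l) = (\<Sum>l\<leftarrow>ms. f l)" for f :: "nat \<Rightarrow> real"
    by (metis assms mset_map sum_mset_sum_list)
  have "2 * spider_harary ls = 2 * spider_harary ms"
    unfolding spider_harary_symmetric_form by (simp only: sum_eq)
  then show ?thesis
    by simp
qed

section \<open>Moving a vertex from a longer leg to a shorter one\<close>

text \<open>Prolonging a leg of length \<open>p\<close> adds a vertex at distance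
  \<open>Suc p\<close> from the centre, which gains \<open>inv_sum m (Suc p)\<close> from a leg of
  length \<open>m\<close>; this gain shrinks as \<open>p\<close> grows.\<close>

lemma leg_pair_transfer:
  assumes "Suc p \<le> q"
  shows "leg_pair p m + leg_pair (Suc q) m \<le> leg_pair (Suc p) m + leg_pair q m"
    and "0 < m \<Longrightarrow> leg_pair p m + leg_pair (Suc q) m < leg_pair (Suc p) m + leg_pair q m"
proof -
  have strict: "inv_sum m (Suc q) < inv_sum m (Suc p)" if "0 < m"
    using inv_sum_strict_antimono[OF that] assms by simp
  then have "inv_sum m (Suc q) \<le> inv_sum m (Suc p)"
    by (cases m) (auto intro: less_imp_le)
  then show "leg_pair p m + leg_pair (Suc q) m \<le> leg_pair (Suc p) m + leg_pair q m"
    by (simp add: leg_pair_Suc_left)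
  show "leg_pair p m + leg_pair (Suc q) m < leg_pair (Suc p) m + leg_pair q m" if "0 < m"
    using strict[OF that] by (simp add: leg_pair_Suc_left)
qed

lemma spider_harary_two:
  "spider_harary (p # q # r) =
     spider_harary r + path_harary (p + q) + (\<Sum>m\<leftarrow>r. leg_pair p m + leg_pair q m)"
  by (simp add: path_harary_add sum_list_addf)

text \<open>The path formed by the two legs and the centre is unchanged, so only the pairs with the
  other legs matter; strictness therefore needs another nonempty leg.\<close>

lemma spider_harary_transfer:
  assumes "Suc p \<le> q"
  shows "spider_harary (p # Suc q # r) \<le> spider_harary (Suc p # q # r)"
    and "\<exists>m\<in>set r. 0 < m \<Longrightarrow> spider_harary (p # Suc q # r) < spider_harary (Suc p # q # r)"
proof -
  have le: "(\<Sum>m\<leftarrow>r. leg_pair p m + leg_pair (Suc q) m) \<le> (\<Sum>m\<leftarrow>r. leg_pair (Suc p) m + leg_pair q m)" for r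
    using leg_pair_transfer(1)[OF assms] by (intro sum_list_mono)
  then show "spider_harary (p # Suc q # r) \<le> spider_harary (Suc p # q # r)"
    by (simp only: spider_harary_two add_Suc add_Suc_right add_left_mono)
  assume "\<exists>m\<in>set r. 0 < m"
  then obtain m xs ys where r: "r = xs @ m # ys" and "0 < m"
    by (auto simp: in_set_conv_decomp)
  have "(\<Sum>m\<leftarrow>r. leg_pair p m + leg_pair (Suc q) m) < (\<Sum>m\<leftarrow>r. leg_pair (Suc p) m + leg_pair q m)"
    using le[of xs] le[of ys] leg_pair_transfer(2)[OF assms \<open>0 < m\<close>] unfolding r by simp
  then show "spider_harary (p # Suc q # r) < spider_harary (Suc p # q # r)"
    by (simp only: spider_harary_two add_Suc add_Suc_right add_strict_left_mono)
qed

section \<open>Balanced lists\<close>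

lemma mset_two_values:
  fixes bs :: "nat list"
  assumes "set bs \<subseteq> {a, Suc a}"
  shows "\<exists>x\<le>length bs. mset bs = replicate_mset (length bs - x) a + replicate_mset x (Suc a)
     \<and> sum_list bs = length bs * a + x"
  using assms
proof (induction bs)
  case (Cons b bs)
  then obtain x where x: "x \<le> length bs"
    "mset bs = replicate_mset (length bs - x) a + replicate_mset x (Suc a)"
    "sum_list bs = length bs * a + x"
    by auto
  from Cons.prems consider "b = a" | "b = Suc a"
    by auto
  then show ?case
  proof cases
    case 1
    with x show ?thesis
      by (intro exI[of _ x]) (simp add: Suc_diff_le)
  next
    case 2
    with x show ?thesis
      by (intro exI[of _ "Suc x"]) simp
  qed
qed simp

text \<open>A balanced list takes at most two consecutive values, so length and sum determine it by
  division with remainder.\<close>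

lemma balanced_mset:
  assumes "balanced bs" "bs \<noteq> []"
  defines "k \<equiv> length bs" and "s \<equiv> sum_list bs"
  shows "mset bs = replicate_mset (k - s mod k) (s div k) + replicate_mset (s mod k) (Suc (s div k))"
proof -
  define a where "a = Min (set bs)"
  have a: "a \<in> set bs" "\<forall>b\<in>set bs. a \<le> b"
    using assms(2) by (auto simp: a_def)
  have "set bs \<subseteq> {a, Suc a}"
  proof
    fix b assume "b \<in> set bs"
    then have "a \<le> b" "b \<le> a + 1"
      using a assms(1) by (auto simp: balanced_def)
    then show "b \<in> {a, Suc a}"
      by auto
  qed
  then obtain x where x: "x \<le> k"
    "mset bs = replicate_mset (k - x) a + replicate_mset x (Suc a)" "s = k * a + x"
    using mset_two_values unfolding k_def s_def by blast
  \<comment> \<open>The minimum \<open>a\<close> occurs in the list, so \<open>x < k\<close>, and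
    \<open>s = k * a + x\<close> is division with remainder.\<close>
  have "x \<noteq> k"
  proof
    assume "x = k"
    with x(2) have "set_mset (mset bs) \<subseteq> {Suc a}"
      by simp
    with a show False by auto
  qed
  with x show ?thesis
    by simp
qed

lemma balanced_mset_eq:
  assumes "balanced cs" "balanced bs" "length cs = length bs" "sum_list cs = sum_list bs"
  shows "mset cs = mset bs"
proof (cases "bs = []")
  case False
  then have "cs \<noteq> []"
    using assms(3) by auto
  then show ?thesis
    using balanced_mset[OF assms(1)] balanced_mset[OF assms(2) False] assms(3,4) by simp
qed (use assms(3) in simp)

lemma balanced_exists:
  assumes "0 < k"
  obtains bs where "balanced bs" "length bs = k" "sum_list bs = s"
proof
  let ?bs = "replicate (k - s mod k) (s div k) @ replicate (s mod k) (Suc (s div k))"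
  have "s mod k < k"
    using assms by simp
  then show "length ?bs = k"
    by simp
  show "balanced ?bs"
    by (auto simp: balanced_def)
  have "sum_list ?bs = (k - s mod k) * (s div k) + s mod k * (s div k) + s mod k"
    by (simp add: sum_list_replicate)
  also have "\<dots> = k * (s div k) + s mod k"
    using \<open>s mod k < k\<close> by (simp add: add_mult_distrib[symmetric])
  finally show "sum_list ?bs = s"
    by simp
qed

lemma balanced_pos:
  assumes "balanced bs" "length bs \<le> sum_list bs" "b \<in> set bs"
  shows "0 < b"
proof (rule ccontr)
  assume "\<not> 0 < b"
  with assms have "\<forall>a\<in>set bs. a \<le> 1"
    by (force simp: balanced_def)
  \<comment> \<open>The extra 1 records an entry 0, so for \<open>bs\<close> itself the sum falls
    below the length.\<close>
  then have "sum_list xs + (if 0 \<in> set xs then 1 else 0) \<le> length xs" if "set xs \<subseteq> set bs" for xs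
    using that by (induction xs) (auto split: if_splits)
  from this[of bs] show False
    using assms \<open>\<not> 0 < b\<close> by auto
qed

section \<open>Optimal leg lengths and optimal level sums\<close>

text \<open>A transfer between legs that differ by more than 1 lowers the sum of squares, so
  transfers end in a balanced list. At least three legs, all positive, make the transfer out of an
  unbalanced list strict.\<close>

lemma spider_harary_le_balanced:
  assumes "balanced bs" "length ls = length bs" "sum_list ls = sum_list bs"
  shows "spider_harary ls \<le> spider_harary bs \<and>
    (3 \<le> length ls \<longrightarrow> 0 \<notin> set ls \<longrightarrow> spider_harary ls = spider_harary bs \<longrightarrow> balanced ls)"
  using assms(2,3)
proof (induction "\<Sum>l\<leftarrow>ls. l * l" arbitrary: ls rule: less_induct)
  case less
  show ?case
  proof (cases "balanced ls")
    case True
    then have "mset ls = mset bs"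
      using assms(1) less.prems by (rule balanced_mset_eq)
    then have "spider_harary ls = spider_harary bs"
      by (rule spider_harary_cong_mset)
    with True show ?thesis
      by simp
  next
    case False
    then obtain p q' where pq': "p \<in> set ls" "q' \<in> set ls" "q' > p + 1"
      unfolding balanced_def by (metis not_less)
    then obtain q where q: "q' = Suc q" "Suc p \<le> q"
      by (cases q') auto
    define r where "r = remove1 q' (remove1 p ls)"
    have "q' \<in> set (remove1 p ls)"
      using pq' by (metis in_set_remove1 less_add_one less_not_refl less_trans)
    then have "mset (remove1 p ls) = add_mset q' (mset r)"
      unfolding r_def by (metis insert_DiffM mset_remove1 set_mset_mset)
    moreover have "mset ls = add_mset p (mset (remove1 p ls))"
      using pq'(1) by (metis insert_DiffM mset_remove1 set_mset_mset)
    ultimately have m: "mset ls = mset (p # Suc q # r)"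
      by (simp only: q(1) mset.simps)
    let ?ls = "Suc p # q # r"
    have sums: "(\<Sum>l\<leftarrow>ls. f l) = (\<Sum>l\<leftarrow>p # Suc q # r. f l)" for f :: "nat \<Rightarrow> nat"
      by (metis m mset_map sum_mset_sum_list)
    have "(\<Sum>l\<leftarrow>?ls. l * l) < (\<Sum>l\<leftarrow>p # Suc q # r. l * l)"
      using q(2) by simp
    then have "(\<Sum>l\<leftarrow>?ls. l * l) < (\<Sum>l\<leftarrow>ls. l * l)"
      unfolding sums[of "\<lambda>l. l * l"] .
    moreover have "length ?ls = length bs"
      using arg_cong[OF m, of size] less.prems by simp
    moreover have "sum_list ?ls = sum_list bs"
      using sums[of "\<lambda>x. x"] less.prems by simp
    ultimately have IH: "spider_harary ?ls \<le> spider_harary bs"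
      using less.hyps by blast
    have eq: "spider_harary ls = spider_harary (p # Suc q # r)"
      by (rule spider_harary_cong_mset[OF m])
    have "spider_harary ls < spider_harary bs" if "3 \<le> length ls" "0 \<notin> set ls"
    proof -
      have "3 \<le> length (p # Suc q # r)"
        using that(1) arg_cong[OF m, of size] by simp
      then obtain x where "x \<in> set r"
        by (cases r) auto
      moreover have "set r \<subseteq> set ls"
        using arg_cong[OF m, of set_mset] by auto
      ultimately have "\<exists>x\<in>set r. 0 < x"
        using that(2) by (metis gr0I subsetD)
      then show ?thesis
        using spider_harary_transfer(2)[OF q(2), of r] IH unfolding eq by linarith
    qed
    then show ?thesis
      using spider_harary_transfer(1)[OF q(2), of r] IH unfolding eq by linarith
  qed
qed

text \<open>Subtracting the value at the largest leg length \<open>q\<close> makes the summands positive below \<open>q\<close>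
  and nonpositive from \<open>q\<close> on, so the best choice is to fill every level below \<open>q\<close>.\<close>
lemma level_sum_le_balanced:
  fixes f :: "'a \<Rightarrow> nat" and g :: "nat \<Rightarrow> real"
  assumes "finite X" "\<And>x. x \<in> X \<Longrightarrow> 0 < f x"
    and level: "\<And>i. 0 < i \<Longrightarrow> card {x\<in>X. f x = i} \<le> k"
    and bs: "balanced bs" "length bs = k" "sum_list bs = card X" "0 < k"
    and g: "\<And>s t. s < t \<Longrightarrow> g t < g s"
  shows "(\<Sum>x\<in>X. g (f x)) \<le> (\<Sum>m\<leftarrow>bs. \<Sum>j<m. g (Suc j))"
    and "(\<Sum>x\<in>X. g (f x)) = (\<Sum>m\<leftarrow>bs. \<Sum>j<m. g (Suc j)) \<Longrightarrow> k \<le> card X \<Longrightarrow> card {x\<in>X. f x = 1} = k"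
proof -
  define q where "q = Max (set bs)"
  define h where "h i = g i - g q" for i
  have "bs \<noteq> []" using bs by auto
  then have q: "q \<in> set bs" "\<And>m. m \<in> set bs \<Longrightarrow> m \<le> q"
    by (auto simp: q_def)
  have gle: "g t \<le> g s" if "s \<le> t" for s t
    using g[of s t] that by (cases "s = t") auto
  \<comment> \<open>Every leg has length \<open>q - 1\<close> or \<open>q\<close>, and
    \<open>h q = 0\<close>; once \<open>g q\<close> is subtracted per vertex, all legs have the same
    sum.\<close>
  have leg: "(\<Sum>j<m. g (Suc j)) = real m * g q + (\<Sum>j<q-1. h (Suc j))" if "m \<in> set bs" for m
  proof -
    have "(\<Sum>j<m. g (Suc j)) = real m * g q + (\<Sum>j<m. h (Suc j))"
      by (simp add: h_def sum_subtractf)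
    moreover have "(\<Sum>j<m. h (Suc j)) = (\<Sum>j<q-1. h (Suc j))"
    proof -
      have "q \<le> m + 1" "m \<le> q"
        using that q bs(1) by (auto simp: balanced_def)
      then consider "m = q - 1" | "m = q" "0 < q" by linarith
      then show ?thesis
      proof cases
        case 2
        then show ?thesis
          by (cases q) (auto simp: h_def)
      qed simp
    qed
    ultimately show ?thesis by simp
  qed
  have "(\<Sum>m\<leftarrow>ms. \<Sum>j<m. g (Suc j)) = real (sum_list ms) * g q + length ms * (\<Sum>j<q-1. h (Suc j))"
    if "set ms \<subseteq> set bs" for ms
    using that by (induction ms) (simp_all add: leg algebra_simps)
  then have R: "(\<Sum>m\<leftarrow>bs. \<Sum>j<m. g (Suc j)) = real (card X) * g q + (\<Sum>j<q-1. k * h (Suc j))"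
    using bs by (simp add: sum_distrib_left)
  have L: "(\<Sum>x\<in>X. g (f x)) = real (card X) * g q + (\<Sum>x\<in>X. h (f x))"
    by (simp add: h_def sum_subtractf)
  let ?Y = "{x\<in>X. f x < q}" and ?Z = "{x\<in>X. q \<le> f x}"
  have "X = ?Y \<union> ?Z" by auto
  then have XYZ: "(\<Sum>x\<in>X. h (f x)) = (\<Sum>x\<in>?Y. h (f x)) + (\<Sum>x\<in>?Z. h (f x))"
    using \<open>finite X\<close> by (metis (no_types, lifting) disjoint_iff finite_Un mem_Collect_eq not_less sum.union_disjoint)
  have Z: "(\<Sum>x\<in>?Z. h (f x)) \<le> 0"
    using gle by (intro sum_nonpos) (auto simp: h_def)
  \<comment> \<open>Grouping by \<open>f x - 1\<close>, as the levels start at 1.\<close>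
  have "(\<Sum>x\<in>?Y. h (f x)) = (\<Sum>j\<in>{..<q-1}. \<Sum>x\<in>{x\<in>?Y. f x - 1 = j}. h (f x))"
    using assms(1,2) by (intro sum.group[symmetric]) (fastforce)+
  also have "\<dots> = (\<Sum>j<q-1. card {x\<in>X. f x = Suc j} * h (Suc j))"
  proof (intro sum.cong refl)
    fix j assume "j \<in> {..<q-1}"
    then have "{x\<in>?Y. f x - 1 = j} = {x\<in>X. f x = Suc j}"
      using assms(2) by fastforce
    then show "(\<Sum>x\<in>{x\<in>?Y. f x - 1 = j}. h (f x)) = card {x\<in>X. f x = Suc j} * h (Suc j)"
      by simp
  qed
  finally have Y: "(\<Sum>x\<in>?Y. h (f x)) = (\<Sum>j<q-1. card {x\<in>X. f x = Suc j} * h (Suc j))" .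
  have hpos: "0 < h (Suc j)" if "j < q - 1" for j
    using g[of "Suc j" q] that by (simp add: h_def)
  have summand: "real (card {x\<in>X. f x = Suc j}) * h (Suc j) \<le> real k * h (Suc j)" if "j < q - 1" for j
    using level[of "Suc j"] hpos[OF that] by (intro mult_right_mono) auto
  have Yle: "(\<Sum>x\<in>?Y. h (f x)) \<le> (\<Sum>j<q-1. k * h (Suc j))"
    unfolding Y by (intro sum_mono summand) simp
  show "(\<Sum>x\<in>X. g (f x)) \<le> (\<Sum>m\<leftarrow>bs. \<Sum>j<m. g (Suc j))"
    unfolding L R XYZ using Yle Z by linarith
  assume eq: "(\<Sum>x\<in>X. g (f x)) = (\<Sum>m\<leftarrow>bs. \<Sum>j<m. g (Suc j))" and "k \<le> card X"
  show "card {x\<in>X. f x = 1} = k"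
  proof (rule ccontr)
    assume "card {x\<in>X. f x = 1} \<noteq> k"
    then have less: "card {x\<in>X. f x = 1} < k"
      using level[of 1] by simp
    have sum_le: "sum_list ms \<le> length ms * q" if "set ms \<subseteq> set bs" for ms
      using that q(2) by (induction ms) (auto simp: add_mono)
    then have cX: "card X \<le> k * q"
      using bs by (metis order_refl)
    \<comment> \<open>For \<open>1 < q\<close>, level 1 has positive weight and a deficit there
      costs strictly. For \<open>q = 1\<close>, a deficit at level 1 pushes some vertex to a higher
      level, where \<open>h\<close> is negative.\<close>
    show False
    proof (cases "1 < q")
      case True
      have "(\<Sum>j<q-1. card {x\<in>X. f x = Suc j} * h (Suc j)) < (\<Sum>j<q-1. k * h (Suc j))"
      proof (rule sum_strict_mono_ex1)
        have "real (card {x\<in>X. f x = Suc 0}) * h (Suc 0) < real k * h (Suc 0)"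
          using less hpos[of 0] True by (intro mult_strict_right_mono) auto
        then show "\<exists>j\<in>{..<q-1}. real (card {x\<in>X. f x = Suc j}) * h (Suc j) < real k * h (Suc j)"
          using True by (intro bexI[of _ 0]) auto
      qed (use summand in auto)
      then show False
        using eq Z unfolding L R XYZ Y by linarith
    next
      case False
      have "q = 1"
      proof -
        have "q \<noteq> 0" using cX \<open>k \<le> card X\<close> bs(4) by (metis le_trans leD mult_0_right)
        with False show ?thesis by simp
      qed
      then have "{x\<in>X. f x = 1} \<noteq> X"
        using less \<open>k \<le> card X\<close> by auto
      then obtain x where x: "x \<in> X" "f x \<noteq> 1" by auto
      then have "1 < f x" using assms(2)[of x] by simp
      then have "h (f x) < 0"
        using g[of 1 "f x"] \<open>q = 1\<close> by (simp add: h_def)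
      moreover have "h (f y) \<le> 0" if "y \<in> ?Z" for y
        using gle[of q "f y"] that by (simp add: h_def)
      ultimately have "(\<Sum>x\<in>?Z. h (f x)) < (\<Sum>x\<in>?Z. 0)"
        using x \<open>1 < f x\<close> \<open>q = 1\<close> \<open>finite X\<close> by (intro sum_strict_mono_ex1) auto
      then show False
        using eq Yle unfolding L R XYZ by simp
    qed
  qed
qed

section \<open>Tree metrics and pendant paths\<close>

text \<open>A tree with adjacency \<open>d y z = 1\<close>: adjacent vertices are never equidistant
  from a third one, and exactly one neighbour of \<open>y\<close> lies towards \<open>x\<close>.
  Apart from \<open>closer_exists\<close>, the axioms are universal and pass to every subset of
  \<open>V\<close>.\<close>

locale tree_metric =
  fixes V :: "'a set" and d :: "'a \<Rightarrow> 'a \<Rightarrow> nat"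
  assumes finite_V: "finite V"
    and dist_0_iff: "\<lbrakk>x \<in> V; y \<in> V\<rbrakk> \<Longrightarrow> d x y = 0 \<longleftrightarrow> x = y"
    and dist_commute: "\<lbrakk>x \<in> V; y \<in> V\<rbrakk> \<Longrightarrow> d x y = d y x"
    and dist_triangle: "\<lbrakk>x \<in> V; y \<in> V; z \<in> V\<rbrakk> \<Longrightarrow> d x z \<le> d x y + d y z"
    and adjacent_dist_neq: "\<lbrakk>x \<in> V; y \<in> V; z \<in> V; d y z = 1\<rbrakk> \<Longrightarrow> d x y \<noteq> d x z"
    and closer_exists: "\<lbrakk>x \<in> V; y \<in> V; x \<noteq> y\<rbrakk> \<Longrightarrow> \<exists>z\<in>V. d y z = 1 \<and> d x y = Suc (d x z)"
    and closer_unique: "\<lbrakk>x \<in> V; y \<in> V; z \<in> V; w \<in> V; d y z = 1; d y w = 1;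
        d x y = Suc (d x z); d x y = Suc (d x w)\<rbrakk> \<Longrightarrow> z = w"

definition nbrs :: "'a set \<Rightarrow> ('a \<Rightarrow> 'a \<Rightarrow> nat) \<Rightarrow> 'a \<Rightarrow> 'a set" where
  "nbrs V d x = {y\<in>V. d x y = 1}"

definition leaves :: "'a set \<Rightarrow> ('a \<Rightarrow> 'a \<Rightarrow> nat) \<Rightarrow> 'a set" where
  "leaves V d = {x\<in>V. card (nbrs V d x) = 1}"

text \<open>The diagonal contributes \<open>1 / 0 = 0\<close>.\<close>
definition harary :: "'a set \<Rightarrow> ('a \<Rightarrow> 'a \<Rightarrow> nat) \<Rightarrow> real" where
  "harary V d = (\<Sum>x\<in>V. \<Sum>y\<in>V. 1 / real (d x y)) / 2"

text \<open>The path \<open>p\<close> starts next to its attachment vertex \<open>v\<close> and ends in a leaf; \<open>(v # p) ! i\<close> is the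
  predecessor of \<open>p ! i\<close>.\<close>
definition pendant :: "'a set \<Rightarrow> ('a \<Rightarrow> 'a \<Rightarrow> nat) \<Rightarrow> 'a \<Rightarrow> 'a list \<Rightarrow> bool" where
  "pendant V d v p \<longleftrightarrow> v \<in> V \<and> set p \<subseteq> V \<and> distinct (v # p) \<and>
     (\<forall>i<length p. \<forall>x\<in>V. d (p ! i) x = 1 \<longleftrightarrow>
        x = (v # p) ! i \<or> (Suc i < length p \<and> x = p ! Suc i))"

definition spider :: "'a set \<Rightarrow> ('a \<Rightarrow> 'a \<Rightarrow> nat) \<Rightarrow> 'a \<Rightarrow> 'a list list \<Rightarrow> bool" where
  "spider V d v ps \<longleftrightarrow> V = set (v # concat ps) \<and> distinct (v # concat ps) \<and>
     (\<forall>p\<in>set ps. pendant V d v p)"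

lemma pendantD:
  assumes "pendant V d v p"
  shows "v \<in> V" "set p \<subseteq> V" "distinct p" "v \<notin> set p"
    and "\<lbrakk>i < length p; x \<in> V\<rbrakk> \<Longrightarrow> d (p ! i) x = 1 \<longleftrightarrow>
        x = (v # p) ! i \<or> (Suc i < length p \<and> x = p ! Suc i)"
  using assms unfolding pendant_def by auto

lemma pendant_subset:
  assumes "pendant V d v p" "U \<subseteq> V" "v \<in> U" "set p \<subseteq> U"
  shows "pendant U d v p"
  using assms unfolding pendant_def by blast

context tree_metric
begin

lemma dist_self [simp]: "x \<in> V \<Longrightarrow> d x x = 0"
  by (simp add: dist_0_iff)

lemma adjacent_dist:
  assumes "x \<in> V" "y \<in> V" "z \<in> V" "d y z = 1"
  shows "d x z = Suc (d x y) \<or> d x y = Suc (d x z)"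
proof -
  have "d x z \<le> d x y + 1" "d x y \<le> d x z + 1"
    using dist_triangle[of x y z] dist_triangle[of x z y] dist_commute[of y z] assms by auto
  with adjacent_dist_neq[OF assms] show ?thesis
    by linarith
qed

lemma finite_nbrs [simp]: "finite (nbrs V d x)"
  using finite_V by (simp add: nbrs_def)

text \<open>The neighbour of \<open>p ! i\<close> closest to \<open>x\<close> cannot be \<open>p ! Suc i\<close>, by downward induction on \<open>i\<close>.\<close>
lemma pendant_closer:
  assumes p: "pendant V d v p" and x: "x \<in> V" "x \<notin> set p"
    and i: "i < length p"
  shows "d x (p ! i) = Suc (d x ((v # p) ! i))"
  using i
proof (induction "length p - i" arbitrary: i rule: less_induct)
  case less
  have pV: "p ! j \<in> V" if "j < length p" for j
    using that pendantD(2)[OF p] by auto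
  have "x \<noteq> p ! i"
    using x less.prems by auto
  then obtain z where z: "z \<in> V" "d (p ! i) z = 1" "d x (p ! i) = Suc (d x z)"
    using closer_exists[OF x(1) pV[OF less.prems]] by blast
  then consider "z = (v # p) ! i" | "Suc i < length p" "z = p ! Suc i"
    using pendantD(5)[OF p less.prems] by blast
  then show ?case
  proof cases
    case 2
    then have "d x (p ! Suc i) = Suc (d x (p ! i))"
      using less.hyps[of "Suc i"] by simp
    with 2 z show ?thesis
      by simp
  qed (use z in simp)
qed

lemma pendant_dist:
  assumes p: "pendant V d v p" and x: "x \<in> V" "x \<notin> set p"
    and i: "i < length p"
  shows "d x (p ! i) = d x v + i + 1"
  using i
proof (induction i)
  case 0
  then show ?case
    using pendant_closer[OF p x, of 0] by simp
next
  case (Suc i)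
  then show ?case
    using pendant_closer[OF p x, of "Suc i"] by simp
qed

text \<open>Turns distances inside a pendant path into distances from a vertex outside one, where
  \<open>pendant_dist\<close> applies.\<close>

lemma pendant_drop:
  assumes p: "pendant V d v p" and i: "i < length p"
  shows "pendant V d (p ! i) (drop (Suc i) p)"
  unfolding pendant_def
proof (intro conjI allI impI ballI)
  show "p ! i \<in> V"
    using pendantD(2)[OF p] i by auto
  show "set (drop (Suc i) p) \<subseteq> V"
    using pendantD(2)[OF p] set_drop_subset[of "Suc i" p] by blast
  show "distinct (p ! i # drop (Suc i) p)"
    using pendantD(3)[OF p] i by (metis Cons_nth_drop_Suc distinct_drop)
  fix j x assume j: "j < length (drop (Suc i) p)" and x: "x \<in> V"
  have "(p ! i # drop (Suc i) p) ! j = (v # p) ! Suc (i + j)"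
    using i j by (cases j) auto
  then show "d (drop (Suc i) p ! j) x = 1 \<longleftrightarrow> x = (p ! i # drop (Suc i) p) ! j \<or>
      Suc j < length (drop (Suc i) p) \<and> x = drop (Suc i) p ! Suc j"
    using pendantD(5)[OF p _ x, of "Suc (i + j)"] i j by auto
qed

lemma pendant_dist_inner:
  assumes p: "pendant V d v p" and ij: "i < j" "j < length p"
  shows "d (p ! i) (p ! j) = j - i"
proof -
  have "d (p ! i) (drop (Suc i) p ! (j - Suc i)) = d (p ! i) (p ! i) + (j - Suc i) + 1"
    using ij pendant_drop[OF p, of i] by (intro pendant_dist) (auto simp: pendant_def)
  moreover have "p ! i \<in> V"
    using ij pendantD(2)[OF p] by auto
  ultimately show ?thesis
    using ij by simp
qed

text \<open>Only \<open>closer_exists\<close> needs an argument: a path vertex adjacent to an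
  outside vertex \<open>y\<close> is farther from \<open>x\<close> than \<open>y\<close>, so the
  neighbour of \<open>y\<close> towards \<open>x\<close> is not on the path.\<close>

lemma tree_metric_pendant:
  assumes p: "pendant V d v p"
  shows "tree_metric (V - set p) d"
proof
  fix x y assume xy: "x \<in> V - set p" "y \<in> V - set p" "x \<noteq> y"
  then obtain z where z: "z \<in> V" "d y z = 1" "d x y = Suc (d x z)"
    using closer_exists[of x y] by auto
  have "z \<notin> set p"
  proof
    assume "z \<in> set p"
    then obtain i where i: "i < length p" "z = p ! i"
      by (auto simp: in_set_conv_nth)
    have "y = (v # p) ! i \<or> (Suc i < length p \<and> y = p ! Suc i)"
      using pendantD(5)[OF p i(1), of y] xy z i dist_commute[of y z] by auto
    then have "y = (v # p) ! i"
      using xy by auto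
    then show False
      using pendant_closer[OF p _ _ i(1), of x] xy z i by auto
  qed
  with z show "\<exists>z\<in>V - set p. d y z = 1 \<and> d x y = Suc (d x z)"
    by blast
qed (use finite_V dist_0_iff dist_commute dist_triangle adjacent_dist_neq closer_unique in auto)

section \<open>Harary index and pendant paths\<close>

text \<open>The pairs within \<open>v # p\<close> form a path with \<open>length p\<close> edges;
  any other outside vertex sees the path through \<open>v\<close>, at distance \<open>d v x\<close>
  from it.\<close>

lemma harary_pendant:
  assumes p: "pendant V d v p"
  shows "harary V d = harary (V - set p) d + path_harary (length p)
     + (\<Sum>x\<in>V - set p - {v}. inv_sum (length p) (d v x))"
proof -
  let ?U = "V - set p" and ?n = "length p" and ?f = "\<lambda>x y. 1 / real (d x y)"
  note pV = pendantD(2)[OF p]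
  have pVn: "p ! i \<in> V" if "i < ?n" for i
    using that pV by auto
  have bij: "bij_betw ((!) p) {..<?n} (set p)"
    using pendantD(3)[OF p] by (rule bij_betw_nth) auto
  have re: "(\<Sum>x\<in>set p. F x) = (\<Sum>i<?n. F (p ! i))" for F :: "'a \<Rightarrow> real"
    using sum.reindex_bij_betw[OF bij, of F] by simp
  have VU: "(\<Sum>x\<in>V. F x) = (\<Sum>x\<in>?U. F x) + (\<Sum>x\<in>set p. F x)" for F :: "'a \<Rightarrow> real"
    using sum.subset_diff[OF pV finite_V] .
  have cross: "(\<Sum>x\<in>?U. \<Sum>y\<in>set p. ?f x y) = (\<Sum>x\<in>?U. inv_sum ?n (d v x))"
  proof (intro sum.cong refl)
    fix x assume x: "x \<in> ?U"
    show "(\<Sum>y\<in>set p. ?f x y) = inv_sum ?n (d v x)"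
      unfolding re inv_sum_def
      using pendant_dist[OF p, of x] x dist_commute[of x v] pendantD(1)[OF p]
      by (intro sum.cong refl) auto
  qed
  have "(\<Sum>x\<in>set p. \<Sum>y\<in>?U. ?f x y) = (\<Sum>x\<in>?U. \<Sum>y\<in>set p. ?f y x)"
    by (rule sum.swap)
  also have "\<dots> = (\<Sum>x\<in>?U. \<Sum>y\<in>set p. ?f x y)"
    using pV by (intro sum.cong refl) (metis DiffD1 dist_commute subsetD)
  finally have cross': "(\<Sum>x\<in>set p. \<Sum>y\<in>?U. ?f x y) = (\<Sum>x\<in>?U. inv_sum ?n (d v x))"
    unfolding cross .
  \<comment> \<open>Going from \<open>m\<close> to \<open>Suc m\<close> adds a row, a column and a
    zero diagonal entry; row and column both sum to \<open>inv_sum m 0\<close>.\<close>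
  have inner: "(\<Sum>i<m. \<Sum>j<m. ?f (p ! i) (p ! j)) = 2 * (\<Sum>i<m. inv_sum i 0)" if "m \<le> ?n" for m
    using that
  proof (induction m)
    case (Suc m)
    have row: "(\<Sum>j<m. ?f (p ! m) (p ! j)) = (\<Sum>j<m. ?f (p ! j) (p ! m))"
      using pVn Suc.prems by (intro sum.cong refl) (simp add: dist_commute)
    have "(\<Sum>j<m. ?f (p ! j) (p ! m)) = (\<Sum>j<m. 1 / real (m - j))"
      using pendant_dist_inner[OF p] Suc.prems by (intro sum.cong refl) simp
    also have "\<dots> = (\<Sum>j<m. 1 / real (m - (m - Suc j)))"
      by (rule sum.nat_diff_reindex[symmetric])
    also have "\<dots> = inv_sum m 0"
      unfolding inv_sum_def by (intro sum.cong refl) simp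
    finally have col: "(\<Sum>j<m. ?f (p ! j) (p ! m)) = inv_sum m 0" .
    have "?f (p ! m) (p ! m) = 0"
      using pVn Suc.prems by simp
    then show ?case
      using Suc row col by (simp add: sum.distrib)
  qed simp
  have "v \<in> ?U" "finite ?U"
    using pendantD[OF p] finite_V by auto
  \<comment> \<open>The term of \<open>v\<close> is split off because it completes the pairs inside
    \<open>p\<close> to \<open>path_harary\<close>, in the form of
    \<open>path_harary_conv\<close>.\<close>
  then have vU: "(\<Sum>x\<in>?U. inv_sum ?n (d v x)) = inv_sum ?n 0 + (\<Sum>x\<in>?U - {v}. inv_sum ?n (d v x))"
    by (subst sum.remove[of _ v]) auto
  have "2 * harary V d = (\<Sum>x\<in>?U. \<Sum>y\<in>?U. ?f x y) + 2 * (\<Sum>x\<in>?U. inv_sum ?n (d v x))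
      + (\<Sum>x\<in>set p. \<Sum>y\<in>set p. ?f x y)"
    unfolding harary_def VU sum.distrib cross cross' by simp
  also have "(\<Sum>x\<in>set p. \<Sum>y\<in>set p. ?f x y) = 2 * (\<Sum>i<?n. inv_sum i 0)"
    unfolding re using inner[of ?n] by simp
  finally show ?thesis
    unfolding vU path_harary_conv harary_def by simp
qed

end

text \<open>Legs are removed one at a time; the sum over the rest in \<open>harary_pendant\<close>
  splits leg by leg into \<open>leg_pair\<close> terms.\<close>

lemma harary_spider:
  assumes "tree_metric V d" "spider V d v ps"
  shows "harary V d = spider_harary (map length ps)"
  using assms
proof (induction ps arbitrary: V)
  case Nil
  then interpret tree_metric V d by simp
  from Nil have "V = {v}"
    by (simp add: spider_def)
  then show ?case
    using dist_0_iff[of v v] by (simp add: harary_def)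
next
  case (Cons p ps)
  then interpret tree_metric V d by simp
  from Cons.prems have V: "V = insert v (set p \<union> set (concat ps))"
    and dist: "distinct (v # p @ concat ps)" and pen: "pendant V d v p" "\<And>q. q \<in> set ps \<Longrightarrow> pendant V d v q"
    by (auto simp: spider_def)
  let ?U = "V - set p"
  have U: "?U = set (v # concat ps)"
    using V dist by auto
  interpret U: tree_metric ?U d
    by (rule tree_metric_pendant[OF pen(1)])
  have penU: "pendant ?U d v q" if "q \<in> set ps" for q
    by (rule pendant_subset[OF pen(2)[OF that]]) (use that U in auto)
  then have "spider ?U d v ps"
    using U dist by (auto simp: spider_def)
  then have IH: "harary ?U d = spider_harary (map length ps)"
    using Cons.IH U.tree_metric_axioms by blast
  have leg: "(\<Sum>x\<in>set q. inv_sum l (d v x)) = leg_pair l (length q)" if "q \<in> set ps" for q l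
  proof -
    note q = penU[OF that]
    have "bij_betw ((!) q) {..<length q} (set q)"
      using pendantD(3)[OF q] by (rule bij_betw_nth) auto
    then have "(\<Sum>x\<in>set q. inv_sum l (d v x)) = (\<Sum>i<length q. inv_sum l (d v (q ! i)))"
      by (rule sum.reindex_bij_betw[symmetric])
    also have "\<dots> = leg_pair l (length q)"
      unfolding leg_pair_def
      by (intro sum.cong refl) (use U.pendant_dist[OF q pendantD(1,4)[OF q]] pendantD(1)[OF q] in simp)
    finally show ?thesis .
  qed
  have "(\<Sum>x\<in>set (concat qs). inv_sum l (d v x)) = (\<Sum>m\<leftarrow>map length qs. leg_pair l m)"
    if "set qs \<subseteq> set ps" "distinct (concat qs)" for qs l
    using that
  proof (induction qs)
    case (Cons q qs)
    then show ?case
      using leg[of q] by (simp add: sum.union_disjoint)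
  qed simp
  moreover have "?U - {v} = set (concat ps)"
    using U dist by auto
  ultimately have "(\<Sum>x\<in>?U - {v}. inv_sum (length p) (d v x)) = (\<Sum>m\<leftarrow>map length ps. leg_pair (length p) m)"
    using dist by simp
  then show ?case
    using harary_pendant[OF pen(1)] IH by simp
qed

section \<open>Existence and removal of pendant paths\<close>

context tree_metric
begin

text \<open>A vertex at maximal distance from \<open>v\<close> has no neighbour farther away, hence
  only the one towards \<open>v\<close>.\<close>

lemma farthest_pendant:
  assumes "v \<in> V" "V \<noteq> {v}"
  obtains u l where "pendant V d u [l]" "l \<noteq> v"
proof -
  have "Max (d v ` V) \<in> d v ` V"
    using assms finite_V by (intro Max_in) auto
  then obtain l where l: "l \<in> V" "d v l = Max (d v ` V)"
    by auto
  then have l: "l \<in> V" "\<And>x. x \<in> V \<Longrightarrow> d v x \<le> d v l"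
    using finite_V by simp_all
  obtain w where "w \<in> V" "w \<noteq> v"
    using assms by auto
  then have "l \<noteq> v"
    using l(2)[of w] dist_0_iff[of v w] assms by auto
  then obtain z where z: "z \<in> V" "d l z = 1" "d v l = Suc (d v z)"
    using closer_exists[of v l] assms l by blast
  have eq: "x = z" if "x \<in> V" "d l x = 1" for x
  proof -
    have "d v l = Suc (d v x)"
      using adjacent_dist[of v l x] assms l that by force
    then show ?thesis
      using closer_unique[of v l x z] that z l assms by blast
  qed
  have "d l x = 1 \<longleftrightarrow> x = z" if "x \<in> V" for x
    using eq[OF that] z(2) by metis
  moreover have "z \<noteq> l"
    using z l by auto
  ultimately have "pendant V d z [l]"
    using z(1) l(1) unfolding pendant_def by simp
  then show ?thesis
    using \<open>l \<noteq> v\<close> that by blast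
qed

lemma pendant_hd_adjacent:
  assumes "pendant V d u p" "p \<noteq> []"
  shows "p ! 0 \<in> nbrs V d u"
  using pendantD(1,2,5)[OF assms(1)] assms(2) dist_commute[of u "p ! 0"]
  by (force simp: nbrs_def)

text \<open>A single edge, at the first vertex of the path, joins a pendant path to the
  rest.\<close>

lemma pendant_adjacent_outside:
  assumes p: "pendant V d u p" and "x \<in> set p" "y \<in> V" "y \<notin> set p" "d x y = 1"
  shows "y = u" "x = p ! 0"
proof -
  obtain i where i: "i < length p" "x = p ! i"
    using assms(2) by (auto simp: in_set_conv_nth)
  then have "y = (u # p) ! i"
    using pendantD(5)[OF p i(1) assms(3)] assms by auto
  with i assms(4) show "y = u" "x = p ! 0"
    by (cases i; auto)+
qed

text \<open>A longest pendant path avoiding \<open>v\<close> cannot be prolonged beyond its attachment vertex.\<close>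
lemma pendant_exists:
  assumes v: "v \<in> V" "V \<noteq> {v}"
  obtains u p where "pendant V d u p" "p \<noteq> []" "v \<notin> set p" "u = v \<or> 3 \<le> card (nbrs V d u)"
proof -
  define P where "P = (\<lambda>(u, p). pendant V d u p \<and> p \<noteq> [] \<and> v \<notin> set p)"
  obtain u0 l where "pendant V d u0 [l]" "l \<noteq> v"
    using farthest_pendant[OF v] .
  then have "P (u0, [l])"
    by (auto simp: P_def)
  moreover have "\<forall>y. P y \<longrightarrow> length (snd y) < Suc (card V)"
  proof (intro allI impI)
    fix y assume "P y"
    then have "set (snd y) \<subseteq> V" "distinct (snd y)"
      by (auto simp: P_def pendant_def split: prod.splits)
    then show "length (snd y) < Suc (card V)"
      by (metis card_mono distinct_card finite_V less_Suc_eq_le)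
  qed
  ultimately obtain y where y: "P y" "\<And>z. P z \<Longrightarrow> length (snd z) \<le> length (snd y)"
    using ex_has_greatest_nat[of P _ "\<lambda>y. length (snd y)"] by blast
  obtain u p where up: "y = (u, p)"
    by fastforce
  have p: "pendant V d u p" "p \<noteq> []" "v \<notin> set p"
    using y(1) by (auto simp: up P_def)
  have "u = v \<or> 3 \<le> card (nbrs V d u)"
  proof (rule ccontr)
    assume "\<not> ?thesis"
    then have uv: "u \<noteq> v" and small: "card (nbrs V d u) \<le> 2"
      by auto
    obtain z where z: "z \<in> V" "d u z = 1" "d v u = Suc (d v z)"
      using closer_exists[of v u] uv v pendantD(1)[OF p(1)] by blast
    have far: "d v (p ! 0) = Suc (d v u)"
      using pendant_dist[OF p(1) v(1) p(3), of 0] p(2) by simp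
    then have "z \<noteq> p ! 0"
      using z by auto
    have sub: "{p ! 0, z} \<subseteq> nbrs V d u"
      using pendant_hd_adjacent[OF p(1,2)] z by (auto simp: nbrs_def)
    \<comment> \<open>With degree at most 2, \<open>u\<close> has only the neighbours
      \<open>p ! 0\<close> and \<open>z\<close>, the one towards \<open>v\<close>; thus
      \<open>u # p\<close> is a longer pendant path, attached at \<open>z\<close>.\<close>
    have nu: "nbrs V d u = {p ! 0, z}"
    proof (rule card_seteq[symmetric])
      show "card (nbrs V d u) \<le> card {p ! 0, z}"
        using small \<open>z \<noteq> p ! 0\<close> by simp
    qed (use sub in auto)
    have "z \<notin> set p"
    proof
      assume "z \<in> set p"
      then have "z = p ! 0"
        using pendant_adjacent_outside[OF p(1), of z u] pendantD(1,4)[OF p(1)] z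
          dist_commute[of u z] by auto
      then show False
        using \<open>z \<noteq> p ! 0\<close> by simp
    qed
    have "pendant V d z (u # p)"
      unfolding pendant_def
    proof (intro conjI allI impI ballI)
      show "distinct (z # u # p)"
        using pendantD[OF p(1)] \<open>z \<notin> set p\<close> z by auto
      show "z \<in> V" "set (u # p) \<subseteq> V"
        using z pendantD[OF p(1)] by auto
      fix i x assume i: "i < length (u # p)" and x: "x \<in> V"
      show "d ((u # p) ! i) x = 1 \<longleftrightarrow>
          x = (z # u # p) ! i \<or> Suc i < length (u # p) \<and> x = (u # p) ! Suc i"
      proof (cases i)
        case 0
        then show ?thesis
          using nu x p(2) by (auto simp: nbrs_def)
      next
        case (Suc j)
        then show ?thesis
          using pendantD(5)[OF p(1), of j x] i x by auto
      qed
    qed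
    then have "P (z, u # p)"
      using p uv by (auto simp: P_def)
    then show False
      using y(2)[of "(z, u # p)"] by (simp add: up)
  qed
  with p that show ?thesis
    by blast
qed

lemma nbrs_remove_pendant:
  assumes p: "pendant V d u p" "p \<noteq> []" and x: "x \<in> V - set p"
  shows "nbrs (V - set p) d x = nbrs V d x - (if x = u then {p ! 0} else {})"
proof -
  have key: "y = p ! 0 \<and> x = u" if "y \<in> set p" "d x y = 1" for y
  proof -
    have "x \<in> V" "x \<notin> set p" "d y x = 1"
      using x that pendantD(2)[OF p(1)] dist_commute[of x y] by auto
    then show ?thesis
      using pendant_adjacent_outside[OF p(1) that(1), of x] by blast
  qed
  have hd: "p ! 0 \<in> set p"
    using p(2) by simp
  show ?thesis
  proof (cases "x = u")
    case True
    have "nbrs (V - set p) d x = nbrs V d x - {p ! 0}"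
      using key hd unfolding nbrs_def by blast
    with True show ?thesis
      by simp
  next
    case False
    have "nbrs (V - set p) d x = nbrs V d x"
      using key False unfolding nbrs_def by blast
    with False show ?thesis
      by simp
  qed
qed

lemma pendant_leaf_iff:
  assumes p: "pendant V d u p" and x: "x \<in> set p"
  shows "x \<in> leaves V d \<longleftrightarrow> x = last p"
proof -
  obtain i where i: "i < length p" "x = p ! i"
    using x by (auto simp: in_set_conv_nth)
  have pV: "(u # p) ! j \<in> V" if "j < Suc (length p)" for j
    using that pendantD(1,2)[OF p] by (cases j) auto
  have nb: "nbrs V d x = {y\<in>V. y = (u # p) ! i \<or> (Suc i < length p \<and> y = p ! Suc i)}"
    unfolding nbrs_def i(2) using pendantD(5)[OF p i(1)] by blast
  have last: "last p = p ! (length p - 1)"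
    using i by (intro last_conv_nth) auto
  have dist: "distinct (u # p)"
    using pendantD[OF p] by simp
  show ?thesis
  proof (cases "Suc i < length p")
    case True
    then have "nbrs V d x = {(u # p) ! i, (u # p) ! Suc (Suc i)}"
      unfolding nb using pV[of i] pV[of "Suc (Suc i)"] by auto
    moreover have "(u # p) ! i \<noteq> (u # p) ! Suc (Suc i)"
      using nth_eq_iff_index_eq[OF dist, of i "Suc (Suc i)"] True by simp
    ultimately have "card (nbrs V d x) = 2"
      by simp
    moreover have "x \<noteq> last p"
      unfolding last i(2) using True pendantD(3)[OF p] by (simp add: nth_eq_iff_index_eq)
    ultimately show ?thesis
      by (simp add: leaves_def)
  next
    case False
    then have "i = length p - 1"
      using i by simp
    then have "x = last p"
      by (simp add: i last)
    moreover have "nbrs V d x = {(u # p) ! i}"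
      unfolding nb using False pV[of i] i by auto
    moreover have "x \<in> V"
      using x pendantD(2)[OF p] by blast
    ultimately show ?thesis
      by (simp add: leaves_def)
  qed
qed

text \<open>The attachment vertex keeps degree at least 2 and does not become a leaf, so
  \<open>last p\<close> is the only leaf lost.\<close>

lemma leaves_remove_pendant:
  assumes p: "pendant V d u p" "p \<noteq> []" and u: "3 \<le> card (nbrs V d u)"
  shows "card (leaves V d) = Suc (card (leaves (V - set p) d))" "u \<notin> leaves (V - set p) d"
    "Suc (card (nbrs (V - set p) d u)) = card (nbrs V d u)"
proof -
  have uU: "u \<in> V - set p"
    using pendantD[OF p(1)] by auto
  show nu: "Suc (card (nbrs (V - set p) d u)) = card (nbrs V d u)"
    using nbrs_remove_pendant[OF p uU] card_Suc_Diff1[OF finite_nbrs pendant_hd_adjacent[OF p]] by simp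
  then show u': "u \<notin> leaves (V - set p) d"
    using u by (simp add: leaves_def)
  have "u \<notin> leaves V d"
    using u by (simp add: leaves_def)
  have "leaves (V - set p) d = leaves V d - {last p}"
  proof (intro set_eqI)
    fix x
    consider "x = u" | "x \<in> V - set p" "x \<noteq> u" | "x \<in> set p" | "x \<notin> V" by blast
    then show "x \<in> leaves (V - set p) d \<longleftrightarrow> x \<in> leaves V d - {last p}"
    proof cases
      case 1
      then show ?thesis using u' \<open>u \<notin> leaves V d\<close> by simp
    next
      case 2
      then have "x \<noteq> last p"
        using p(2) by auto
      then show ?thesis
        using nbrs_remove_pendant[OF p 2(1)] 2 by (auto simp: leaves_def)
    next
      case 3
      then show ?thesis
        using pendant_leaf_iff[OF p(1) 3] by (auto simp: leaves_def)
    next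
      case 4
      then show ?thesis by (simp add: leaves_def)
    qed
  qed
  moreover have "last p \<in> leaves V d"
    using pendant_leaf_iff[OF p(1), of "last p"] p(2) by simp
  moreover have "finite (leaves V d)"
    using finite_V by (simp add: leaves_def)
  ultimately show "card (leaves V d) = Suc (card (leaves (V - set p) d))"
    by (metis card_Suc_Diff1)
qed

section \<open>Levels, leaves and degrees\<close>

text \<open>A neighbour other than the one towards \<open>v\<close> lies farther from
  \<open>v\<close>.\<close>

lemma child_exists:
  assumes "v \<in> V" "x \<in> V" "x \<noteq> v" "x \<notin> leaves V d"
  obtains y where "y \<in> V" "d y x = 1" "d v y = Suc (d v x)"
proof -
  obtain z where z: "z \<in> V" "d x z = 1" "d v x = Suc (d v z)"
    using closer_exists[of v x] assms by blast
  have "nbrs V d x \<noteq> {z}"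
    using assms by (auto simp: leaves_def)
  then obtain y where y: "y \<in> V" "d x y = 1" "y \<noteq> z"
    using z by (auto simp: nbrs_def)
  have "d v x \<noteq> Suc (d v y)"
    using closer_unique[of v x y z] y z assms by blast
  then have "d v y = Suc (d v x)"
    using adjacent_dist[of v x y] y assms by blast
  then show ?thesis
    using that y assms dist_commute[of x y] by simp
qed

text \<open>Non-leaves at level \<open>i\<close> have distinct children at level
  \<open>Suc i\<close>, while leaves at level \<open>i\<close> count for themselves. Downward
  induction thus bounds level \<open>i\<close> by the number of leaves at distance at least
  \<open>i\<close>.\<close>

lemma card_level_le_leaves:
  assumes v: "v \<in> V" and "0 < i"
  shows "card {x\<in>V. d v x = i} \<le> card (leaves V d - {v})"
proof -
  have fin: "finite (leaves V d)"
    using finite_V by (simp add: leaves_def)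
  define M where "M = Max (d v ` V)"
  have M: "d v x \<le> M" if "x \<in> V" for x
    using finite_V that by (simp add: M_def)
  have "card {x\<in>V. d v x = i} \<le> card {x\<in>leaves V d. i \<le> d v x}"
    using \<open>0 < i\<close>
  proof (induction "Suc M - i" arbitrary: i rule: less_induct)
    case less
    show ?case
    proof (cases "i \<le> M")
      case False
      then have "{x\<in>V. d v x = i} = {}"
        using M by force
      then show ?thesis
        by (simp only: card.empty)
    next
      case True
      let ?N = "{x\<in>V - leaves V d. d v x = i}" and ?L = "{x\<in>leaves V d. d v x = i}"
      have "\<forall>x\<in>?N. \<exists>y. y \<in> V \<and> d y x = 1 \<and> d v y = Suc i"
      proof
        fix x assume x: "x \<in> ?N"
        then have "x \<noteq> v"
          using less.prems v by auto
        then show "\<exists>y. y \<in> V \<and> d y x = 1 \<and> d v y = Suc i"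
          using child_exists[OF v, of x] x by auto
      qed
      then obtain c where c: "\<And>x. x \<in> ?N \<Longrightarrow> c x \<in> V \<and> d (c x) x = 1 \<and> d v (c x) = Suc i"
        by metis
      have "inj_on c ?N"
      proof (rule inj_onI)
        fix x y assume "x \<in> ?N" "y \<in> ?N" "c x = c y"
        then show "x = y"
          using closer_unique[of v "c x" x y] c[of x] c[of y] v by auto
      qed
      moreover have "c ` ?N \<subseteq> {x\<in>V. d v x = Suc i}"
        using c by auto
      ultimately have "card ?N \<le> card {x\<in>V. d v x = Suc i}"
        using finite_V by (intro card_inj_on_le) auto
      also have "\<dots> \<le> card {x\<in>leaves V d. Suc i \<le> d v x}"
        using less.hyps[of "Suc i"] True by simp
      finally have "card ?L + card ?N \<le> card ?L + card {x\<in>leaves V d. Suc i \<le> d v x}"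
        by simp
      also have "\<dots> = card (?L \<union> {x\<in>leaves V d. Suc i \<le> d v x})"
        using fin by (intro card_Un_disjoint[symmetric]) auto
      also have "?L \<union> {x\<in>leaves V d. Suc i \<le> d v x} = {x\<in>leaves V d. i \<le> d v x}"
        by auto
      finally have "card ?L + card ?N \<le> card {x\<in>leaves V d. i \<le> d v x}" .
      moreover have "{x\<in>V. d v x = i} = ?L \<union> ?N"
        by (auto simp: leaves_def)
      ultimately show ?thesis
        using card_Un_le[of ?L ?N] by simp
    qed
  qed
  also have "\<dots> \<le> card (leaves V d - {v})"
    using fin v \<open>0 < i\<close> by (intro card_mono) auto
  finally show ?thesis .
qed

text \<open>Root the tree at \<open>v\<close>: every other vertex is a child of exactly one vertex.\<close>
lemma degree_sum:
  assumes v: "v \<in> V"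
  shows "int (card (nbrs V d v)) = (\<Sum>x\<in>V - {v}. 2 - int (card (nbrs V d x)))"
proof -
  define ch where "ch x = {y\<in>V. d x y = 1 \<and> d v y = Suc (d v x)}" for x
  have nb: "card (nbrs V d x) = Suc (card (ch x))" if x: "x \<in> V - {v}" for x
  proof -
    obtain z where z: "z \<in> V" "d x z = 1" "d v x = Suc (d v z)"
      using closer_exists[of v x] x v by blast
    have "nbrs V d x = insert z (ch x)"
      using z x v closer_unique[of v x _ z] adjacent_dist[of v x] by (auto simp: nbrs_def ch_def)
    moreover have "z \<notin> ch x"
      using z by (simp add: ch_def)
    ultimately show ?thesis
      using finite_V by (simp add: ch_def)
  qed
  have "nbrs V d v = ch v"
    using v by (auto simp: nbrs_def ch_def)
  have "V - {v} = (\<Union>x\<in>V. ch x)"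
  proof (intro equalityI subsetI)
    fix y assume "y \<in> V - {v}"
    then show "y \<in> (\<Union>x\<in>V. ch x)"
      using closer_exists[of v y] v dist_commute unfolding ch_def by fastforce
  qed (use v in \<open>auto simp: ch_def\<close>)
  moreover have "card (\<Union>x\<in>V. ch x) = (\<Sum>x\<in>V. card (ch x))"
  proof (rule card_UN_disjoint)
    show "\<forall>x\<in>V. \<forall>y\<in>V. x \<noteq> y \<longrightarrow> ch x \<inter> ch y = {}"
    proof (intro ballI impI equals0I)
      fix x y z assume xy: "x \<in> V" "y \<in> V" "x \<noteq> y" and "z \<in> ch x \<inter> ch y"
      then have z: "z \<in> V" "d x z = 1" "d y z = 1" "d v z = Suc (d v x)" "d v z = Suc (d v y)"
        by (auto simp: ch_def)
      then have "d z x = 1" "d z y = 1"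
        using xy dist_commute[of x z] dist_commute[of y z] by simp_all
      with z xy v show False
        using closer_unique[of v z x y] by blast
    qed
  qed (use finite_V in \<open>auto simp: ch_def\<close>)
  ultimately have "card (V - {v}) = card (ch v) + (\<Sum>x\<in>V - {v}. card (ch x))"
    using v finite_V by (simp add: sum.remove[of V v])
  then have "int (card (V - {v})) = int (card (ch v)) + (\<Sum>x\<in>V - {v}. int (card (nbrs V d x)) - 1)"
    using nb by simp
  then show ?thesis
    using finite_V by (simp add: sum_subtractf \<open>nbrs V d v = ch v\<close>)
qed

text \<open>In \<open>degree_sum\<close> a leaf contributes 1 and any other vertex at most 0. If the
  total reaches the number of leaves, no term can be negative.\<close>

lemma degree_le_2_if_card_nbrs_eq_leaves:
  assumes v: "v \<in> V" and eq: "card (nbrs V d v) = card (leaves V d - {v})" and x: "x \<in> V - {v}"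
  shows "card (nbrs V d x) \<le> 2"
proof (rule ccontr)
  assume large: "\<not> ?thesis"
  let ?f = "\<lambda>x. 2 - int (card (nbrs V d x))" and ?g = "\<lambda>x. if x \<in> leaves V d then 1 else 0 :: int"
  have le: "?f y \<le> ?g y" if y: "y \<in> V - {v}" for y
  proof -
    have "nbrs V d y \<noteq> {}"
      using closer_exists[of v y] y v by (auto simp: nbrs_def)
    then have "0 < card (nbrs V d y)"
      by (simp add: card_gt_0_iff)
    then show ?thesis
      using y by (auto simp: leaves_def)
  qed
  have "?f x < ?g x"
    using large by simp
  then have "(\<Sum>y\<in>V - {v}. ?f y) < (\<Sum>y\<in>V - {v}. ?g y)"
    by (intro sum_strict_mono_ex1 ballI bexI[of _ x] le) (use x finite_V in simp_all)
  also have "(\<Sum>y\<in>V - {v}. ?g y) = int (card (leaves V d - {v}))"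
  proof -
    have "(V - {v}) \<inter> leaves V d = leaves V d - {v}"
      by (auto simp: leaves_def)
    then show ?thesis
      using sum.inter_restrict[of "V - {v}" "\<lambda>_. 1 :: int" "leaves V d"] finite_V by simp
  qed
  finally show False
    using degree_sum[OF v] eq by simp
qed

end

section \<open>The extremal bound\<close>

text \<open>A pendant path touches the rest only at \<open>v\<close>, so the legs of the smaller
  tree gain no neighbours.\<close>

lemma (in tree_metric) spider_insert:
  assumes p: "pendant V d v p" and ps: "spider (V - set p) d v ps"
  shows "spider V d v (p # ps)"
proof -
  have U: "V - set p = set (v # concat ps)" and dist: "distinct (v # concat ps)"
    using ps by (simp_all add: spider_def)
  have "pendant V d v q" if q: "q \<in> set ps" for q
  proof -
    have pq: "pendant (V - set p) d v q"
      using ps q unfolding spider_def by blast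
    have "\<not> d (q ! i) x = 1 \<and> x \<noteq> (v # q) ! i \<and> \<not> (Suc i < length q \<and> x = q ! Suc i)"
      if i: "i < length q" and x: "x \<in> set p" for i x
    proof -
      have qi: "q ! i \<in> V - set p" "q ! i \<noteq> v"
        using i pendantD[OF pq] nth_mem by blast+
      have "x \<in> V"
        using x pendantD(2)[OF p] by blast
      then have "d (q ! i) x \<noteq> 1"
        using pendant_adjacent_outside(1)[OF p x, of "q ! i"] qi dist_commute[of x "q ! i"] by auto
      moreover have "(v # q) ! i \<in> V - set p"
        using i pendantD(1,2)[OF pq] nth_mem[of i "v # q"] by auto
      moreover have "q ! Suc i \<in> V - set p" if "Suc i < length q"
        using that pendantD(2)[OF pq] nth_mem by blast
      ultimately show ?thesis
        using x by blast
    qed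
    then show ?thesis
      using pq unfolding pendant_def by blast
  qed
  moreover have "V = set (v # concat (p # ps))"
    using U pendantD(2)[OF p] by auto
  moreover have "distinct (v # concat (p # ps))"
    using U dist pendantD(3,4)[OF p] by auto
  ultimately show ?thesis
    using p unfolding spider_def by simp
qed

text \<open>The degree bound forces the path from \<open>pendant_exists\<close> to be attached at
  \<open>v\<close>, and the bound survives its removal.\<close>

lemma spider_exists:
  assumes "tree_metric V d" "v \<in> V" "\<And>x. x \<in> V - {v} \<Longrightarrow> card (nbrs V d x) \<le> 2"
  shows "\<exists>ps. spider V d v ps \<and> [] \<notin> set ps"
  using assms
proof (induction "card V" arbitrary: V rule: less_induct)
  case less
  then interpret tree_metric V d by simp
  show ?case
  proof (cases "V = {v}")
    case True
    then show ?thesis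
      by (intro exI[of _ "[]"]) (simp add: spider_def)
  next
    case False
    then obtain u p where up: "pendant V d u p" "p \<noteq> []" "v \<notin> set p" "u = v \<or> 3 \<le> card (nbrs V d u)"
      using pendant_exists less.prems(2) by blast
    have "u = v"
    proof (rule ccontr)
      assume "u \<noteq> v"
      then show False
        using less.prems(3)[of u] up pendantD(1)[OF up(1)] by auto
    qed
    with up have p: "pendant V d v p" "p \<noteq> []" by auto
    let ?U = "V - set p"
    have "?U \<subset> V"
      using p pendantD(2)[OF p(1)] by (cases p) auto
    then have "card ?U < card V"
      using finite_V by (rule psubset_card_mono[rotated])
    moreover have "v \<in> ?U"
      using pendantD[OF p(1)] by simp
    moreover have "card (nbrs ?U d x) \<le> 2" if "x \<in> ?U - {v}" for x
      using less.prems(3)[of x] nbrs_remove_pendant[OF p, of x] that by simp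
    ultimately obtain ps where "spider ?U d v ps" "[] \<notin> set ps"
      using less.hyps[of ?U] tree_metric_pendant[OF p(1)] by blast
    then have "spider V d v (p # ps)" "[] \<notin> set (p # ps)"
      using spider_insert[OF p(1)] p(2) by auto
    then show ?thesis
      by blast
  qed
qed

lemma card_image_distinct_concat:
  assumes "distinct (concat ps)" "[] \<notin> set ps" and f: "\<And>p. p \<in> set ps \<Longrightarrow> f p \<in> set p"
  shows "card (f ` set ps) = length ps"
  using assms
proof (induction ps)
  case (Cons p ps)
  then have "f p \<in> set p" "set p \<inter> set (concat ps) = {}" "f ` set ps \<subseteq> set (concat ps)"
    by auto
  then have "f p \<notin> f ` set ps"
    by blast
  then show ?case
    using Cons by simp
qed simp

context tree_metric
begin

lemma card_nbrs_spider:
  assumes s: "spider V d v ps" "[] \<notin> set ps"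
  shows "card (nbrs V d v) = length ps"
proof -
  have V: "V = insert v (set (concat ps))" and dist: "distinct (concat ps)"
    and pen: "\<And>p. p \<in> set ps \<Longrightarrow> pendant V d v p"
    using s by (auto simp: spider_def)
  have "nbrs V d v = hd ` set ps"
  proof (intro equalityI subsetI)
    fix x assume x: "x \<in> nbrs V d v"
    then have "x \<in> V" "d v x = 1" "x \<noteq> v"
      using V by (auto simp: nbrs_def)
    then obtain p where p: "p \<in> set ps" "x \<in> set p"
      using V by auto
    have "d x v = 1"
      using \<open>x \<in> V\<close> \<open>d v x = 1\<close> dist_commute[of x v] V by simp
    then have "x = p ! 0"
      using pendant_adjacent_outside(2)[OF pen[OF p(1)] p(2), of v] pendantD(1,4)[OF pen[OF p(1)]]
      by blast
    then have "x = hd p"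
      using p by (cases p) auto
    with p show "x \<in> hd ` set ps"
      by blast
  next
    fix x assume "x \<in> hd ` set ps"
    then obtain p where p: "p \<in> set ps" "x = hd p"
      by blast
    then have "p \<noteq> []"
      using s(2) by blast
    then show "x \<in> nbrs V d v"
      using pendant_hd_adjacent[OF pen[OF p(1)]] p by (simp add: hd_conv_nth)
  qed
  then show ?thesis
    using card_image_distinct_concat[OF dist s(2), of hd] s(2) by (metis hd_in_set)
qed

text \<open>With a single leg, the centre is a leaf as well.\<close>

lemma card_leaves_spider:
  assumes s: "spider V d v ps" "[] \<notin> set ps"
  shows "card (leaves V d) = (if length ps = 1 then 2 else length ps)"
proof -
  have V: "V = insert v (set (concat ps))" and dist: "distinct (concat ps)" "v \<notin> set (concat ps)"
    and pen: "\<And>p. p \<in> set ps \<Longrightarrow> pendant V d v p"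
    using s by (auto simp: spider_def)
  have vleaf: "v \<in> leaves V d \<longleftrightarrow> length ps = 1"
    using card_nbrs_spider[OF s] V by (simp add: leaves_def)
  have last: "last p \<in> set p" if "p \<in> set ps" for p
    using that s(2) by (metis last_in_set)
  have "leaves V d - {v} = last ` set ps"
  proof (intro equalityI subsetI)
    fix x assume x: "x \<in> leaves V d - {v}"
    then obtain p where p: "p \<in> set ps" "x \<in> set p"
      using V by (auto simp: leaves_def)
    then show "x \<in> last ` set ps"
      using pendant_leaf_iff[OF pen[OF p(1)] p(2)] x by blast
  next
    fix x assume "x \<in> last ` set ps"
    then obtain p where p: "p \<in> set ps" "x = last p"
      by blast
    then have "x \<in> set p"
      using last by simp
    then show "x \<in> leaves V d - {v}"
      using pendant_leaf_iff[OF pen[OF p(1)], of x] p dist(2) by auto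
  qed
  moreover have "card (last ` set ps) = length ps"
    using card_image_distinct_concat[OF dist(1) s(2), of last] last by blast
  moreover have "finite (leaves V d)"
    using finite_V by (simp add: leaves_def)
  ultimately show ?thesis
    using vleaf card_Suc_Diff1[of "leaves V d" v] by (cases "length ps = 1") auto
qed

lemma card_spider:
  assumes "spider V d v ps"
  shows "card V = Suc (sum_list (map length ps))"
proof -
  have "V = set (v # concat ps)" "distinct (v # concat ps)"
    using assms by (simp_all add: spider_def)
  then have "card V = length (v # concat ps)"
    by (metis distinct_card)
  then show ?thesis
    by (simp add: length_concat)
qed

end

lemma length_2_spider_harary:
  assumes "length bs = 2"
  shows "spider_harary bs = path_harary (sum_list bs)"
proof -
  obtain a b where "bs = [a, b]"
    using assms by (auto simp: length_Suc_conv numeral_2_eq_2)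
  then show ?thesis
    using spider_harary_two[of a b "[]"] by simp
qed

section \<open>Induction over pendant paths\<close>

text \<open>The list \<open>bs\<close> is quantified inside, so that the smaller tree can be
  compared with a list \<open>cs\<close> of its own; the bound on the number of leaves guarantees
  that such a balanced list exists.\<close>

lemma harary_le_balanced_spider:
  assumes "tree_metric V d" "2 \<le> card V"
  shows "2 \<le> card (leaves V d) \<and>
    (\<forall>bs. balanced bs \<longrightarrow> length bs = card (leaves V d) \<longrightarrow> Suc (sum_list bs) = card V \<longrightarrow>
       harary V d \<le> spider_harary bs \<and>
       (3 \<le> card (leaves V d) \<longrightarrow> harary V d = spider_harary bs \<longrightarrow>
         (\<exists>v ps. spider V d v ps \<and> [] \<notin> set ps \<and> length ps = card (leaves V d)
            \<and> balanced (map length ps))))"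
  using assms
proof (induction "card V" arbitrary: V rule: less_induct)
  case less
  then interpret tree_metric V d by simp
  show ?case
  proof (cases "\<exists>b\<in>V. 3 \<le> card (nbrs V d b)")
    case False
    \<comment> \<open>Without a branching vertex the tree is a path, which has one or two legs as
      seen from an arbitrary vertex.\<close>
    obtain v where v: "v \<in> V"
      using less.prems by force
    have "card (nbrs V d x) \<le> 2" if "x \<in> V" for x
    proof -
      have "\<not> 3 \<le> card (nbrs V d x)"
        using False that by blast
      then show ?thesis
        by simp
    qed
    then obtain ps where ps: "spider V d v ps" "[] \<notin> set ps"
      using spider_exists[OF less.prems(1) v] by blast
    have "ps \<noteq> []"
      using card_spider[OF ps(1)] less.prems(2) by auto
    moreover have "length ps \<le> 2"
      using card_nbrs_spider[OF ps] \<open>\<And>x. x \<in> V \<Longrightarrow> card (nbrs V d x) \<le> 2\<close>[OF v] by simp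
    ultimately consider "length ps = 1" | "length ps = 2"
      by (cases ps; cases "tl ps") auto
    then have "harary V d = path_harary (sum_list (map length ps)) \<and> card (leaves V d) = 2"
    proof cases
      case 1
      then obtain p where "ps = [p]"
        by (auto simp: length_Suc_conv)
      then show ?thesis
        using harary_spider[OF less.prems(1) ps(1)] card_leaves_spider[OF ps] by simp
    next
      case 2
      then show ?thesis
        using harary_spider[OF less.prems(1) ps(1)] card_leaves_spider[OF ps]
          length_2_spider_harary[of "map length ps"] by simp
    qed
    then show ?thesis
      using length_2_spider_harary card_spider[OF ps(1)] by auto
  next
    case True
    then obtain b where b: "b \<in> V" "3 \<le> card (nbrs V d b)"
      by blast
    have "V \<noteq> {b}"
    proof
      assume "V = {b}"
      then have "nbrs V d b \<subseteq> {}"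
        using dist_self[OF b(1)] by (auto simp: nbrs_def)
      with b(2) show False
        by simp
    qed
    then obtain v p where p: "pendant V d v p" "p \<noteq> []" and deg: "3 \<le> card (nbrs V d v)"
      using pendant_exists[OF b(1)] b(2) by metis
    let ?U = "V - set p"
    note U = tree_metric_pendant[OF p(1)]
    interpret U: tree_metric ?U d
      by (rule U)
    have v: "v \<in> V" "v \<in> ?U"
      using pendantD[OF p(1)] by auto
    define \<kappa> where "\<kappa> = card (leaves ?U d)"
    note lv = leaves_remove_pendant[OF p deg]
    have "card (nbrs ?U d v) \<le> card ?U"
      using finite_V by (intro card_mono) (auto simp: nbrs_def)
    then have "2 \<le> card ?U"
      using lv(3) deg by simp
    moreover have "?U \<subset> V"
      using p pendantD(2)[OF p(1)] by (cases p) auto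
    then have "card ?U < card V"
      using finite_V by (rule psubset_card_mono[rotated])
    ultimately have IH: "2 \<le> \<kappa>" "\<And>bs. balanced bs \<Longrightarrow> length bs = \<kappa> \<Longrightarrow> Suc (sum_list bs) = card ?U
        \<Longrightarrow> harary ?U d \<le> spider_harary bs"
      using less.hyps[OF _ U] unfolding \<kappa>_def by blast+
    define X where "X = ?U - {v}"
    have cX: "card ?U = Suc (card X)"
      using card_Suc_Diff1[OF U.finite_V v(2)] by (simp add: X_def)
    have cV: "card V = Suc (card X + length p)"
      using card_Diff_subset[of "set p" V] pendantD(2)[OF p(1)] cX \<open>card ?U < card V\<close>
        distinct_card[OF pendantD(3)[OF p(1)]] by simp
    obtain cs where cs: "balanced cs" "length cs = \<kappa>" "sum_list cs = card X"
      using balanced_exists[of \<kappa>] IH(1) by auto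
    have leaves_v: "leaves ?U d - {v} = leaves ?U d"
      using lv(2) by simp
    have level: "card {x\<in>X. d v x = i} \<le> \<kappa>" if "0 < i" for i
    proof -
      have "card {x\<in>X. d v x = i} \<le> card {x\<in>?U. d v x = i}"
        using finite_V by (intro card_mono) (auto simp: X_def)
      also have "\<dots> \<le> \<kappa>"
        using U.card_level_le_leaves[OF v(2) that] unfolding leaves_v \<kappa>_def .
      finally show ?thesis .
    qed
    have X: "finite X" "\<And>x. x \<in> X \<Longrightarrow> 0 < d v x"
      using finite_V dist_0_iff[OF v(1)] by (auto simp: X_def)
    have g: "inv_sum (length p) t < inv_sum (length p) s" if "s < t" for s t
      using inv_sum_strict_antimono[OF _ that] p(2) by simp
    have "0 < \<kappa>"
      using IH(1) by simp
    note lsum = level_sum_le_balanced[where g = "inv_sum (length p)", OF X level cs this g, folded leg_pair_def]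
    have H: "harary V d = harary ?U d + path_harary (length p) + (\<Sum>x\<in>X. inv_sum (length p) (d v x))"
      unfolding X_def by (rule harary_pendant[OF p(1)])
    have IHcs: "harary ?U d \<le> spider_harary cs"
      using IH(2)[OF cs(1,2)] cs(3) cX by simp
    \<comment> \<open>The recursion for \<open>length p # cs\<close> has the same three terms as
      \<open>H\<close>, and these are compared one by one.\<close>
    have le1: "harary V d \<le> spider_harary (length p # cs)"
      using H IHcs lsum(1) by simp
    have k: "card (leaves V d) = Suc \<kappa>"
      using lv(1) by (simp add: \<kappa>_def)
    show ?thesis
    proof (intro conjI allI impI)
      show "2 \<le> card (leaves V d)"
        using IH(1) k by simp
      fix bs assume bs: "balanced bs" "length bs = card (leaves V d)" "Suc (sum_list bs) = card V"
      have le2: "spider_harary (length p # cs) \<le> spider_harary bs"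
        using spider_harary_le_balanced[OF bs(1), of "length p # cs"] bs cs k cV by simp
      then show "harary V d \<le> spider_harary bs"
        using le1 by simp
      assume "3 \<le> card (leaves V d)" and eq: "harary V d = spider_harary bs"
      \<comment> \<open>Equality with the balanced value makes every estimate in the chain tight, in
        particular the one for the level sum.\<close>
      have "(\<Sum>x\<in>X. inv_sum (length p) (d v x)) = (\<Sum>m\<leftarrow>cs. leg_pair (length p) m)"
        using H IHcs lsum(1) le2 eq by simp
      moreover have "\<kappa> \<le> card X"
        unfolding \<kappa>_def using X(1) lv(2) by (intro card_mono) (auto simp: X_def leaves_def)
      ultimately have "card {x\<in>X. d v x = 1} = \<kappa>"
        using lsum(2) by blast
      moreover have "{x\<in>X. d v x = 1} = nbrs ?U d v"
        using dist_self[OF v(1)] by (auto simp: X_def nbrs_def)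
      ultimately have deg_v: "card (nbrs V d v) = card (leaves V d)"
        using lv(3) k by simp
      moreover have "leaves V d - {v} = leaves V d"
        using deg by (auto simp: leaves_def)
      ultimately have "card (nbrs V d x) \<le> 2" if "x \<in> V - {v}" for x
        using degree_le_2_if_card_nbrs_eq_leaves[OF v(1) _ that] by simp
      then obtain ps where ps: "spider V d v ps" "[] \<notin> set ps"
        using spider_exists[OF less.prems(1) v(1)] by blast
      have len: "length ps = card (leaves V d)"
        using card_nbrs_spider[OF ps] deg_v by simp
      have "spider_harary (map length ps) = spider_harary bs"
        using harary_spider[OF less.prems(1) ps(1)] eq by simp
      moreover have "0 \<notin> set (map length ps)"
        using ps(2) by auto
      ultimately have "balanced (map length ps)"
        using spider_harary_le_balanced[OF bs(1), of "map length ps"] len bs card_spider[OF ps(1)]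
          \<open>3 \<le> card (leaves V d)\<close> by simp
      with ps len show "\<exists>v ps. spider V d v ps \<and> [] \<notin> set ps \<and> length ps = card (leaves V d)
            \<and> balanced (map length ps)"
        by blast
    qed
  qed
qed

section \<open>Trees as graphs\<close>

text \<open>The distance with values in \<open>nat\<close>, as \<open>tree_metric\<close> requires;
  it agrees with \<open>graph_dist\<close> on the vertices of a tree.\<close>

definition hops :: "'a pair_pre_digraph \<Rightarrow> 'a \<Rightarrow> 'a \<Rightarrow> nat" where
  "hops G x y = (LEAST n. \<exists>p. pre_digraph.awalk (with_proj G) x p y \<and> length p = n)"

text \<open>The graph-theoretic part of \<open>balanced_starlike\<close>; empty legs are
  allowed.\<close>

definition starlike :: "'a pair_pre_digraph \<Rightarrow> 'a \<Rightarrow> 'a list list \<Rightarrow> bool" where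
  "starlike G v ps \<longleftrightarrow> distinct (v # concat ps) \<and> pverts G = set (v # concat ps) \<and>
     parcs G = (\<Union>p \<in> set ps. (set (vwalk_arcs (v # p)))\<^sup>s)"

text \<open>If two paths from \<open>y\<close> to \<open>x\<close> start differently, following the first up to the point where the
  second meets it and returning along the second gives a cycle of length at least 3.\<close>
lemma (in pair_graph) apath_first_arc_unique:
  assumes acyclic: "\<not> (\<exists>p. cycle p \<and> 3 \<le> length p)"
    and e: "apath y (e # p) x" and f: "apath y (f # q) x"
  shows "e = f"
proof (rule ccontr)
  assume "e \<noteq> f"
  have E: "e \<in> parcs G" "fst e = y" "apath (snd e) p x" "y \<notin> set (pawalk_verts (snd e) p)"
    and F: "f \<in> parcs G" "fst f = y" "apath (snd f) q x" "y \<notin> set (pawalk_verts (snd f) q)"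
    using e f by (auto simp: apath_Cons_iff)
  let ?vp = "pawalk_verts (snd e) p" and ?vq = "pawalk_verts (snd f) q"
  have aw: "awalk (snd e) p x" "awalk (snd f) q x"
    using E F by (auto intro: awalkI_apath)
  have "x \<in> set ?vp" "x \<in> set ?vq"
    using awlast_of_awalk[OF aw(1)] awlast_of_awalk[OF aw(2)]
    by (metis aw awalkE' awalk_verts_non_Nil last_in_set)+
  \<comment> \<open>\<open>w\<close> is the first vertex of the second path that lies on the first
    one, so \<open>xs\<close> avoids the first path and the closed walk below repeats no vertex
    except its start.\<close>
  then obtain xs w ys where vq: "?vq = xs @ w # ys" and w: "w \<in> set ?vp"
      and first: "\<forall>z\<in>set xs. z \<notin> set ?vp"
    using split_list_first_prop[of ?vq "\<lambda>z. z \<in> set ?vp"] by blast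
  have "pcas (snd f) q x"
    using aw(2) by (auto elim: awalkE')
  then obtain q1 r where q1: "pcas (snd f) q1 w" "q = q1 @ r" "pawalk_verts (snd f) q1 = xs @ [w]"
    using awalk_decomp_verts[OF _ vq, of x] by metis
  obtain us bs where vp: "?vp = us @ w # bs"
    using w by (meson split_list)
  have "pcas (snd e) p x"
    using aw(1) by (auto elim: awalkE')
  then obtain p1 s where p1: "pcas (snd e) p1 w" "p = p1 @ s" "pawalk_verts (snd e) p1 = us @ [w]"
    using awalk_decomp_verts[OF _ vp, of x] by metis
  have aw1: "awalk (snd e) p1 w" "awalk (snd f) q1 w"
    using aw p1(1,2) q1(1,2) unfolding awalk_def by auto
  have walk_e: "awalk y (e # p1) w" and walk_f: "awalk y (f # q1) w"
    using aw1 E F by (simp_all add: awalk_Cons_iff)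
  let ?c = "(e # p1) @ rev_path (f # q1)"
  have walk_back: "awalk w (rev_path (f # q1)) y"
    by (rule awalk_rev_path'[OF walk_f])
  have c: "awalk y ?c y"
    using awalk_appendI[OF walk_e walk_back] .
  have last: "last (pawalk_verts y (e # p1)) = w"
    using p1(3) by simp
  have "pawalk_verts w (rev_path (f # q1)) = rev (pawalk_verts y (f # q1))"
    by (rule awalk_verts_rev_path[OF walk_f])
  also have "\<dots> = w # rev xs @ [y]"
    using q1(3) F by simp
  finally have verts: "tl (pawalk_verts y ?c) = us @ [w] @ rev xs @ [y]"
    using awalk_verts_append[OF c] p1(3) unfolding last by simp
  have "distinct ?vp" "distinct ?vq"
    using E F by (auto simp: apath_def)
  then have "distinct (us @ [w] @ rev xs @ [y])"
    using first vp vq E(4) F(4) by auto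
  then have "cycle ?c"
    using c verts unfolding cycle_def by (metis append_is_Nil_conv list.discI)
  \<comment> \<open>If both pieces were empty, \<open>e\<close> and \<open>f\<close> would be the
    same arc.\<close>
  moreover have "3 \<le> length ?c"
  proof -
    have "p1 \<noteq> [] \<or> q1 \<noteq> []"
    proof (rule ccontr)
      assume "\<not> ?thesis"
      then have "snd e = w" "snd f = w"
        using p1(1) q1(1) by simp_all
      with E F \<open>e \<noteq> f\<close> show False
        by (metis prod.collapse)
    qed
    moreover have "length (rev_path l) = length l" for l :: "('a \<times> 'a) list"
      by (induction l) auto
    ultimately show ?thesis
      by (cases p1; cases q1) auto
  qed
  ultimately show False
    using acyclic by blast
qed

section \<open>The tree metric of a graph\<close>

locale graph_tree = pair_graph +
  assumes simple_tree: "simple_graph_tree G"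
begin

lemma acyclic: "\<not> (\<exists>p. cycle p \<and> 3 \<le> length p)"
  using simple_tree by (simp add: simple_graph_tree_def)

lemma awalk_exists:
  assumes "x \<in> pverts G" "y \<in> pverts G"
  obtains p where "awalk x p y"
proof -
  have "strongly_connected (with_proj G)"
    using symmetric_connected_imp_strongly_connected pair_sym_arcs simple_tree
    by (simp add: simple_graph_tree_def)
  then have "x \<rightarrow>\<^sup>*\<^bsub>with_proj G\<^esub> y"
    using assms by (auto simp: strongly_connected_def)
  then show ?thesis
    using that by (auto simp: reachable_awalk)
qed

lemma geodesic_exists:
  assumes "x \<in> pverts G" "y \<in> pverts G"
  obtains p where "awalk x p y" "length p = hops G x y"
proof -
  obtain q where "awalk x q y"
    using awalk_exists assms .
  then have "\<exists>n p. awalk x p y \<and> length p = n"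
    by blast
  from LeastI_ex[OF this] show ?thesis
    using that unfolding hops_def by blast
qed

lemma hops_le: "awalk x p y \<Longrightarrow> hops G x y \<le> length p"
  unfolding hops_def by (rule Least_le) blast

lemma hops_0_iff:
  assumes "x \<in> pverts G" "y \<in> pverts G"
  shows "hops G x y = 0 \<longleftrightarrow> x = y"
proof
  assume "hops G x y = 0"
  then show "x = y"
    using geodesic_exists[OF assms] by (metis awalk_empty_ends length_0_conv)
next
  assume "x = y"
  then show "hops G x y = 0"
    using hops_le[of x "[]" y] assms by (simp add: awalk_Nil_iff)
qed

lemma hops_1_iff:
  assumes "x \<in> pverts G" "y \<in> pverts G"
  shows "hops G x y = 1 \<longleftrightarrow> (x, y) \<in> parcs G"
proof
  assume "hops G x y = 1"
  then obtain p where "awalk x p y" "length p = 1"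
    using geodesic_exists[OF assms] by metis
  then show "(x, y) \<in> parcs G"
    by (cases p) (auto simp: awalk_simps)
next
  assume arc: "(x, y) \<in> parcs G"
  then have "hops G x y \<le> 1"
    using hops_le[of x "[(x, y)]" y] assms by (simp add: awalk_simps)
  moreover have "x \<noteq> y"
    using arc pair_no_loops by fastforce
  ultimately show "hops G x y = 1"
    using hops_0_iff[OF assms] by simp
qed

lemma hops_commute_le:
  assumes "x \<in> pverts G" "y \<in> pverts G"
  shows "hops G y x \<le> hops G x y"
proof -
  obtain p where p: "awalk x p y" "length p = hops G x y"
    using geodesic_exists[OF assms] .
  have "length (rev_path l) = length l" for l :: "('a \<times> 'a) list"
    by (induction l) auto
  then show ?thesis
    using hops_le[of y "rev_path p" x] p by simp
qed

lemma hops_commute: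
  assumes "x \<in> pverts G" "y \<in> pverts G"
  shows "hops G x y = hops G y x"
  using hops_commute_le assms by (simp add: le_antisym)

lemma hops_triangle:
  assumes "x \<in> pverts G" "y \<in> pverts G" "z \<in> pverts G"
  shows "hops G x z \<le> hops G x y + hops G y z"
proof -
  obtain p q where "awalk x p y" "length p = hops G x y" "awalk y q z" "length q = hops G y z"
    using geodesic_exists assms by metis
  then show ?thesis
    using hops_le[OF awalk_appendI, of x p y q z] by simp
qed

lemma geodesic_apath:
  assumes "awalk x p y" "length p \<le> hops G x y"
  shows "apath x p y"
proof (rule ccontr)
  assume "\<not> ?thesis"
  then have "\<not> distinct (pawalk_verts x p)"
    using assms by (simp add: apath_def)
  then obtain q r s w where "length p = length (q @ r @ s)" "0 < length r" "awalk x q w" "awalk w s y"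
    using awalk_not_distinct_decomp[OF assms(1)] by metis
  moreover from this have "hops G x y \<le> length q + length s"
    using hops_le[OF awalk_appendI, of x q w s y] by simp
  ultimately show False
    using assms(2) unfolding length_append by linarith
qed

text \<open>Prepares \<open>apath_first_arc_unique\<close>: the arc to a closer neighbour starts a
  geodesic, which is a path.\<close>

lemma closer_apath:
  assumes "x \<in> pverts G" "y \<in> pverts G" "z \<in> pverts G" "hops G y z = 1" "hops G x y = Suc (hops G x z)"
  obtains p where "apath y ((y, z) # p) x"
proof -
  obtain p where p: "awalk z p x" "length p = hops G z x"
    using geodesic_exists assms by metis
  have "awalk y ((y, z) # p) x"
    using p hops_1_iff assms by (simp add: awalk_simps)
  moreover have "length ((y, z) # p) \<le> hops G y x"
    using p(2) assms hops_commute by simp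
  ultimately show ?thesis
    using that geodesic_apath by blast
qed

lemma hops_closer_exists:
  assumes "x \<in> pverts G" "y \<in> pverts G" "x \<noteq> y"
  shows "\<exists>z\<in>pverts G. hops G y z = 1 \<and> hops G x y = Suc (hops G x z)"
proof -
  obtain p where p: "awalk y p x" "length p = hops G y x"
    using geodesic_exists assms by metis
  then obtain e q where "p = e # q"
    using assms hops_0_iff by (cases p) auto
  then have e: "(y, snd e) \<in> parcs G" "awalk (snd e) q x" "hops G y x = Suc (length q)"
    using p by (auto simp: awalk_simps)
  then have z: "snd e \<in> pverts G" "hops G y (snd e) = 1"
    using hops_1_iff assms in_arcsD2 by auto
  have "hops G (snd e) x \<le> length q"
    by (rule hops_le[OF e(2)])
  moreover have "hops G y x \<le> 1 + hops G (snd e) x"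
    using hops_triangle[of y "snd e" x] z assms by simp
  ultimately have "hops G x y = Suc (hops G x (snd e))"
    using e(3) hops_commute[of x y] hops_commute[of x "snd e"] z assms by simp
  then show ?thesis
    using z by blast
qed

lemma tree_metric_hops: "tree_metric (pverts G) (hops G)"
proof
  show "finite (pverts G)"
    by (rule pair_finite_verts)
next
  fix x y z w
  assume V: "x \<in> pverts G" "y \<in> pverts G" "z \<in> pverts G" "w \<in> pverts G"
    and "hops G y z = 1" "hops G y w = 1" "hops G x y = Suc (hops G x z)" "hops G x y = Suc (hops G x w)"
  then obtain p q where "apath y ((y, z) # p) x" "apath y ((y, w) # q) x"
    using closer_apath by metis
  then show "z = w"
    using apath_first_arc_unique[OF acyclic] by blast
next
  fix x y z
  assume V: "x \<in> pverts G" "y \<in> pverts G" "z \<in> pverts G" and yz: "hops G y z = 1"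
  \<comment> \<open>If \<open>y\<close> and \<open>z\<close> were equidistant from \<open>x\<close>,
    two paths from \<open>y\<close> to \<open>x\<close> would start differently: a geodesic and the
    detour through \<open>z\<close>.\<close>
  show "hops G x y \<noteq> hops G x z"
  proof
    assume eq: "hops G x y = hops G x z"
    have arc: "(y, z) \<in> parcs G"
      using hops_1_iff V yz by blast
    then have "y \<noteq> z"
      using pair_no_loops by fastforce
    then have "x \<noteq> y"
      using eq V hops_0_iff[of y y] hops_0_iff[of y z] by auto
    then obtain u where u: "u \<in> pverts G" "hops G y u = 1" "hops G x y = Suc (hops G x u)"
      using hops_closer_exists V by blast
    obtain p where p: "apath y ((y, u) # p) x"
      using closer_apath V u by metis
    obtain q where q: "awalk z q x" "length q = hops G z x"
      using geodesic_exists V by metis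
    \<comment> \<open>A geodesic from \<open>z\<close> through \<open>y\<close> would be no longer
      than its part from \<open>y\<close> on, which forces \<open>y = z\<close>.\<close>
    have "y \<notin> set (pawalk_verts z q)"
    proof
      assume "y \<in> set (pawalk_verts z q)"
      then obtain q1 q2 where q12: "q = q1 @ q2" "awalk z q1 y" "awalk y q2 x"
        using awalk_decomp[OF q(1)] by blast
      then have "length q2 \<ge> length q"
        using hops_le[OF q12(3)] q(2) eq V hops_commute by simp
      then have "q1 = []"
        using q12(1) by simp
      then show False
        using q12(2) \<open>y \<noteq> z\<close> awalk_empty_ends by blast
    qed
    then have "apath y ((y, z) # q) x"
      using arc geodesic_apath[OF q(1)] q(2) by (simp add: apath_Cons_iff)
    then have "u = z"
      using apath_first_arc_unique[OF acyclic p] by blast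
    then show False
      using u eq by simp
  qed
qed (use hops_0_iff hops_commute hops_triangle hops_closer_exists in auto)

lemma graph_dist_eq_hops:
  assumes "x \<in> pverts G" "y \<in> pverts G"
  shows "graph_dist G x y = real (hops G x y)"
proof -
  have cost: "awalk_cost (\<lambda>_. 1) p = real (length p)" for p :: "('a \<times> 'a) list"
    by (induction p) simp_all
  obtain p where p: "awalk x p y" "length p = hops G x y"
    using geodesic_exists[OF assms] .
  have "\<mu> (\<lambda>_. 1) x y = ereal (real (hops G x y))"
  proof (rule antisym)
    show "\<mu> (\<lambda>_. 1) x y \<le> ereal (real (hops G x y))"
      using min_cost_le_walk_cost[OF p(1), of "\<lambda>_. 1"] p(2) by (simp add: cost)
    show "ereal (real (hops G x y)) \<le> \<mu> (\<lambda>_. 1) x y"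
      unfolding \<mu>_def using hops_le by (intro INF_greatest) (simp add: cost)
  qed
  then show ?thesis
    by (simp add: graph_dist_def)
qed

lemma harary_index_eq: "harary_index G = harary (pverts G) (hops G)"
proof -
  let ?V = "pverts G"
  have "(\<Sum>(x, y) \<in> {(x, y). x \<in> ?V \<and> y \<in> ?V \<and> x \<noteq> y}. 1 / graph_dist G x y)
      = (\<Sum>(x, y) \<in> ?V \<times> ?V. 1 / real (hops G x y))"
    using pair_finite_verts hops_0_iff
    by (intro sum.mono_neutral_cong_left) (auto simp: graph_dist_eq_hops)
  then show ?thesis
    by (simp add: harary_index_def harary_def sum.cartesian_product)
qed

lemma pendent_vertices_eq: "pendent_vertices G = leaves (pverts G) (hops G)"
proof -
  have "out_degree (with_proj G) v = card (nbrs (pverts G) (hops G) v)" if "v \<in> pverts G" for v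
  proof -
    have "out_arcs (with_proj G) v = Pair v ` nbrs (pverts G) (hops G) v"
      using hops_1_iff[OF that] in_arcsD2 by (force simp: out_arcs_def nbrs_def)
    then show ?thesis
      by (simp add: out_degree_def card_image inj_on_def)
  qed
  then show ?thesis
    by (auto simp: pendent_vertices_def leaves_def)
qed

end

section \<open>Starlike graphs and spiders\<close>

lemma set_vwalk_arcs_conv_nth:
  "set (vwalk_arcs (v # p)) = (\<lambda>i. ((v # p) ! i, p ! i)) ` {..<length p}"
proof (induction p arbitrary: v)
  case (Cons x p)
  have "{..<length (x # p)} = insert 0 (Suc ` {..<length p})"
    by (simp add: lessThan_Suc_eq_insert_0)
  then show ?case
    using Cons by (simp add: image_image)
qed simp

lemma distinct_concat_eq:
  assumes "distinct (concat ps)" "p \<in> set ps" "q \<in> set ps" "x \<in> set p" "x \<in> set q"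
  shows "p = q"
  using assms by (auto simp: distinct_concat_iff)

text \<open>Each leg vertex occupies one position of one leg, so its arcs lead only to the adjacent
  positions. The right-hand side has the form used in \<open>pendant\<close>.\<close>

lemma starlike_arc_iff:
  assumes "starlike G v ps" "p \<in> set ps" "i < length p"
  shows "(p ! i, x) \<in> parcs G \<longleftrightarrow> x = (v # p) ! i \<or> (Suc i < length p \<and> x = p ! Suc i)"
proof
  have dist: "distinct (v # concat ps)"
    and arcs: "parcs G = (\<Union>p \<in> set ps. (set (vwalk_arcs (v # p)))\<^sup>s)"
    using assms(1) by (simp_all add: starlike_def)
  have mem: "p ! i \<in> set p" "p ! i \<noteq> v"
    using assms(2,3) dist by auto
  have idx: "q = p \<and> j = i" if "q \<in> set ps" "j < length q" "q ! j = p ! i" for q j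
  proof -
    have "q = p"
      using distinct_concat_eq[of ps q p "p ! i"] that mem dist assms(2) nth_mem[of j q] by simp
    moreover have "distinct p"
      using dist assms(2) by (simp add: distinct_concat_iff)
    ultimately show ?thesis
      using that assms(3) nth_eq_iff_index_eq by blast
  qed
  {
    assume "(p ! i, x) \<in> parcs G"
    then obtain q j where q: "q \<in> set ps" "j < length q"
      and "(p ! i, x) = ((v # q) ! j, q ! j) \<or> (p ! i, x) = (q ! j, (v # q) ! j)"
      unfolding arcs set_vwalk_arcs_conv_nth symcl_def by auto
    then consider "p ! i = (v # q) ! j" "x = q ! j" | "p ! i = q ! j" "x = (v # q) ! j"
      by auto
    then show "x = (v # p) ! i \<or> (Suc i < length p \<and> x = p ! Suc i)"
    proof cases
      case 1
      then obtain j' where "j = Suc j'"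
        using mem(2) by (cases j) auto
      then show ?thesis
        using 1 idx[of q j'] q by auto
    next
      case 2
      then show ?thesis
        using idx[of q j] q by auto
    qed
  }
  have sub: "(set (vwalk_arcs (v # p)))\<^sup>s \<subseteq> parcs G"
    using arcs assms(2) by blast
  assume "x = (v # p) ! i \<or> (Suc i < length p \<and> x = p ! Suc i)"
  then show "(p ! i, x) \<in> parcs G"
  proof
    assume "x = (v # p) ! i"
    then have "(x, p ! i) \<in> set (vwalk_arcs (v # p))"
      using assms(3) unfolding set_vwalk_arcs_conv_nth by blast
    then have "(p ! i, x) \<in> (set (vwalk_arcs (v # p)))\<^sup>s"
      by (force simp: symcl_def)
    with sub show ?thesis by blast
  next
    assume "Suc i < length p \<and> x = p ! Suc i"
    then have "(p ! i, x) \<in> set (vwalk_arcs (v # p))"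
      unfolding set_vwalk_arcs_conv_nth by force
    then have "(p ! i, x) \<in> (set (vwalk_arcs (v # p)))\<^sup>s"
      by (simp add: symcl_def)
    with sub show ?thesis by blast
  qed
qed

lemma (in graph_tree) spider_if_starlike:
  assumes "starlike G v ps"
  shows "spider (pverts G) (hops G) v ps"
proof -
  have V: "pverts G = set (v # concat ps)" and dist: "distinct (v # concat ps)"
    using assms by (simp_all add: starlike_def)
  have "pendant (pverts G) (hops G) v p" if p: "p \<in> set ps" for p
    unfolding pendant_def
  proof (intro conjI allI impI ballI)
    show "v \<in> pverts G" "set p \<subseteq> pverts G" "distinct (v # p)"
      using V dist p by (auto simp: distinct_concat_iff)
    fix i x assume i: "i < length p" and x: "x \<in> pverts G"
    have "p ! i \<in> pverts G"
      using i \<open>set p \<subseteq> pverts G\<close> by auto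
    then show "hops G (p ! i) x = 1 \<longleftrightarrow> x = (v # p) ! i \<or> Suc i < length p \<and> x = p ! Suc i"
      using hops_1_iff x starlike_arc_iff[OF assms p i] by simp
  qed
  then show ?thesis
    using V dist by (simp add: spider_def)
qed

text \<open>As there are no loops, every arc has an end on some leg, and there
  \<open>pendant\<close> describes all arcs.\<close>

lemma (in graph_tree) starlike_if_spider:
  assumes s: "spider (pverts G) (hops G) v ps"
  shows "starlike G v ps"
proof -
  have V: "pverts G = set (v # concat ps)" and dist: "distinct (v # concat ps)"
    and pen: "\<And>p. p \<in> set ps \<Longrightarrow> pendant (pverts G) (hops G) v p"
    using s by (auto simp: spider_def)
  let ?R = "\<Union>p \<in> set ps. (set (vwalk_arcs (v # p)))\<^sup>s"
  have symR: "(y, x) \<in> ?R" if "(x, y) \<in> ?R" for x y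
    using that by (auto simp: symcl_def)
  have leg: "(x, y) \<in> ?R" if p: "p \<in> set ps" "x \<in> set p" and xy: "(x, y) \<in> parcs G" for p x y
  proof -
    obtain i where i: "i < length p" "x = p ! i"
      using p(2) by (auto simp: in_set_conv_nth)
    have "hops G x y = 1"
      using hops_1_iff xy in_arcsD1[OF xy] in_arcsD2[OF xy] by blast
    then consider "y = (v # p) ! i" | "Suc i < length p" "y = p ! Suc i"
      using pendantD(5)[OF pen[OF p(1)] i(1) in_arcsD2[OF xy]] i(2) by blast
    then have "(y, x) \<in> set (vwalk_arcs (v # p)) \<or> (x, y) \<in> set (vwalk_arcs (v # p))"
      unfolding set_vwalk_arcs_conv_nth i(2) using i(1) by cases force+
    then show ?thesis
      using p(1) by (force simp: symcl_def)
  qed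
  have "parcs G \<subseteq> ?R"
  proof (rule subrelI)
    fix x y assume xy: "(x, y) \<in> parcs G"
    then have "x \<noteq> y"
      using pair_no_loops by fastforce
    then consider p where "p \<in> set ps" "x \<in> set p" | p where "p \<in> set ps" "y \<in> set p"
      using in_arcsD1[OF xy] in_arcsD2[OF xy] unfolding V by auto
    then show "(x, y) \<in> ?R"
    proof cases
      case 1
      then show ?thesis by (rule leg[OF _ _ xy])
    next
      case 2
      then show ?thesis by (rule symR[OF leg[OF _ _ arcs_symmetric[OF xy]]])
    qed
  qed
  moreover have "(x, y) \<in> parcs G" if p: "p \<in> set ps" and xy: "(x, y) \<in> set (vwalk_arcs (v # p))" for p x y
  proof -
    obtain i where i: "i < length p" "x = (v # p) ! i" "y = p ! i"
      using xy unfolding set_vwalk_arcs_conv_nth by auto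
    have "x \<in> set (v # p)" "y \<in> set p"
      unfolding i(2,3) using i(1) by (auto intro: nth_mem simp del: set_simps nth_Cons)
    then have xyV: "x \<in> pverts G" "y \<in> pverts G"
      using pendantD(1,2)[OF pen[OF p]] by auto
    then have "hops G y x = 1"
      using pendantD(5)[OF pen[OF p] i(1), of x] i by simp
    then have "(y, x) \<in> parcs G"
      using hops_1_iff xyV by blast
    then show ?thesis
      by (rule arcs_symmetric)
  qed
  then have "?R \<subseteq> parcs G"
    using arcs_symmetric by (auto simp: symcl_def)
  ultimately show ?thesis
    using V dist by (simp add: starlike_def)
qed

section \<open>Starlike graphs are trees\<close>

lemma (in wf_digraph) awalk_nth:
  assumes "awalk u p w"
  shows "Suc i < length p \<Longrightarrow> tail G (p ! Suc i) = head G (p ! i)"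
    and "p \<noteq> [] \<Longrightarrow> tail G (p ! 0) = u \<and> head G (p ! (length p - 1)) = w"
proof -
  show "Suc i < length p \<Longrightarrow> tail G (p ! Suc i) = head G (p ! i)"
    using assms
  proof (induction p arbitrary: u i)
    case (Cons e p)
    then have "awalk (head G e) p w"
      by (simp add: awalk_simps)
    with Cons show ?case
      by (cases i; cases p) (auto simp: awalk_simps)
  qed simp
  show "p \<noteq> [] \<Longrightarrow> tail G (p ! 0) = u \<and> head G (p ! (length p - 1)) = w"
    using assms
  proof (induction p arbitrary: u)
    case (Cons e p)
    then show ?case
      by (cases p) (auto simp: awalk_simps)
  qed simp
qed

text \<open>The two neighbours of a vertex of maximal rank on a long cycle would be distinct.\<close>
lemma (in pair_wf_digraph) acyclic_if_rank:
  fixes r :: "'a \<Rightarrow> nat"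
  assumes lower: "\<And>x y z. \<lbrakk>(y, x) \<in> parcs G; (x, z) \<in> parcs G; r y \<le> r x; r z \<le> r x\<rbrakk> \<Longrightarrow> y = z"
  shows "\<not> (\<exists>p. cycle p \<and> 3 \<le> length p)"
proof
  assume "\<exists>p. cycle p \<and> 3 \<le> length p"
  then obtain p u where p: "awalk u p u" "distinct (tl (pawalk_verts u p))" "3 \<le> length p"
    by (auto simp: cycle_def)
  let ?n = "length p"
  define nxt where "nxt i = (if Suc i = ?n then 0 else Suc i)" for i
  define prv where "prv i = (if i = 0 then ?n - 1 else i - 1)" for i
  have nxt: "fst (p ! nxt i) = snd (p ! i)" if "i < ?n" for i
  proof (cases "Suc i = ?n")
    case True
    then have "i = ?n - 1" by simp
    then show ?thesis
      using awalk_nth(2)[OF p(1)] True by (cases p) (auto simp: nxt_def)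
  next
    case False
    then show ?thesis
      using awalk_nth(1)[OF p(1), of i] that by (simp add: nxt_def)
  qed
  have "pcas u p u"
    using p(1) by (auto elim: awalkE')
  then have "tl (pawalk_verts u p) = map snd p"
    using awalk_verts_conv'[of u p u] p(3) by auto
  then have inj: "snd (p ! i) = snd (p ! j) \<longleftrightarrow> i = j" if "i < ?n" "j < ?n" for i j
    using p(2) that by (metis length_map nth_eq_iff_index_eq nth_map)
  have arcs: "p ! i \<in> parcs G" if "i < ?n" for i
    using p(1) that by (auto elim!: awalkE')
  define M where "M = Max (r ` snd ` set p)"
  have "M \<in> r ` snd ` set p"
    unfolding M_def using p(3) by (intro Max_in) auto
  then obtain i where i: "i < ?n" "r (snd (p ! i)) = M"
    by (auto simp: in_set_conv_nth)
  have le: "r (snd (p ! j)) \<le> M" if "j < ?n" for j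
    unfolding M_def using that by (intro Max_ge) auto
  \<comment> \<open>Length at least 3 matters here: on a back-and-forth walk \<open>nxt i\<close>
    and \<open>prv i\<close> coincide.\<close>
  have nn: "nxt i < ?n" "prv i < ?n" "nxt (prv i) = i" "nxt i \<noteq> prv i"
    using i(1) p(3) by (auto simp: nxt_def prv_def)
  have "fst (p ! i) = snd (p ! prv i)"
    using nxt[OF nn(2)] nn(3) by simp
  moreover have "fst (p ! i) = snd (p ! nxt i)"
  proof (rule lower)
    show "(fst (p ! i), snd (p ! i)) \<in> parcs G"
      using arcs[OF i(1)] by simp
    show "(snd (p ! i), snd (p ! nxt i)) \<in> parcs G"
      using arcs[OF nn(1)] nxt[OF i(1)] by (metis prod.collapse)
    show "r (fst (p ! i)) \<le> r (snd (p ! i))"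
      using le[OF nn(2)] i(2) \<open>fst (p ! i) = snd (p ! prv i)\<close> by simp
    show "r (snd (p ! nxt i)) \<le> r (snd (p ! i))"
      using le[OF nn(1)] i(2) by simp
  qed
  ultimately show False
    using inj[OF nn(1,2)] nn(4) by simp
qed

lemma pair_graph_if_starlike:
  assumes "starlike G v ps"
  shows "pair_graph G"
proof -
  have dist: "distinct (v # concat ps)" and V: "pverts G = set (v # concat ps)"
    and arcs: "parcs G = (\<Union>p \<in> set ps. (set (vwalk_arcs (v # p)))\<^sup>s)"
    using assms by (simp_all add: starlike_def)
  have arc: "\<exists>p i. p \<in> set ps \<and> i < length p \<and> (e = ((v # p) ! i, p ! i) \<or> e = (p ! i, (v # p) ! i))"
    if "e \<in> parcs G" for e
    using that unfolding arcs set_vwalk_arcs_conv_nth symcl_def by auto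
  have step: "(v # p) ! i \<in> pverts G \<and> p ! i \<in> pverts G \<and> (v # p) ! i \<noteq> p ! i"
    if "p \<in> set ps" "i < length p" for p i
  proof -
    have "set (v # p) \<subseteq> pverts G"
      using V that(1) by auto
    moreover have "(v # p) ! i \<in> set (v # p)" "p ! i \<in> set (v # p)"
      using that(2) nth_mem[of i "v # p"] by auto
    moreover have "distinct (v # p)"
      using dist that(1) by (auto simp: distinct_concat_iff)
    then have "(v # p) ! i \<noteq> (v # p) ! Suc i"
      using that(2) nth_eq_iff_index_eq[of "v # p" i "Suc i"] by simp
    ultimately show ?thesis
      by auto
  qed
  have "finite (parcs G)"
    unfolding arcs symcl_def by auto
  moreover have "sym (parcs G)"
    unfolding arcs by (rule symI) (auto simp: symcl_def)
  moreover have "fst e \<in> pverts G \<and> snd e \<in> pverts G \<and> fst e \<noteq> snd e" if "e \<in> parcs G" for e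
    using arc[OF that] step by fastforce
  ultimately show ?thesis
    by unfold_locales (auto simp: V symmetric_def)
qed

lemma simple_graph_tree_if_starlike:
  assumes s: "starlike G v ps"
  shows "simple_graph_tree G"
proof -
  interpret pair_graph G
    by (rule pair_graph_if_starlike[OF s])
  have dist: "distinct (v # concat ps)" and V: "pverts G = set (v # concat ps)"
    using s by (simp_all add: starlike_def)
  have vV: "v \<in> pverts G"
    using V by simp
  note arc = starlike_arc_iff[OF s]
  have "\<exists>w. awalk v w (p ! i)" if "p \<in> set ps" "i < length p" for p i
    using that(2)
  proof (induction i)
    case 0
    then have "(v, p ! 0) \<in> parcs G"
      using arc[OF that(1), of 0] arcs_symmetric by auto
    then have "awalk v [(v, p ! 0)] (p ! 0)"
      using in_arcsD2 by (auto simp: awalk_simps)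
    then show ?case by blast
  next
    case (Suc i)
    then obtain w where w: "awalk v w (p ! i)"
      by auto
    have "(p ! i, p ! Suc i) \<in> parcs G"
      using arc[OF that(1), of i] Suc.prems by auto
    then have "awalk (p ! i) [(p ! i, p ! Suc i)] (p ! Suc i)"
      using in_arcsD2 by (auto simp: awalk_simps)
    with w show ?case
      using awalk_appendI by blast
  qed
  then have from_v: "\<exists>w. awalk v w x" if "x \<in> pverts G" for x
    using that vV unfolding V by (auto simp: in_set_conv_nth awalk_Nil_iff V intro: exI[of _ "[]"])
  have conn: "Digraph_Component.connected (with_proj G)"
  proof (rule connectedI)
    show "pverts G \<noteq> {}"
      using V by simp
    fix x y assume "x \<in> pverts G" "y \<in> pverts G"
    then obtain p q where "awalk v p x" "awalk v q y"
      using from_v by blast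
    then have "awalk x (rev_path p @ q) y"
      using awalk_appendI[of x "rev_path p" v q y] by simp
    then have "x \<rightarrow>\<^sup>*\<^bsub>with_proj G\<^esub> y"
      by (rule reachable_awalkI)
    then show "x \<rightarrow>\<^sup>*\<^bsub>with_proj (mk_symmetric (with_proj G))\<^esub> y"
      using reachable_mk_symmetric_eq[OF pair_sym_arcs] by simp
  qed
  \<comment> \<open>The rank is the distance from the centre; an arc to a vertex of no larger rank
    can only lead to the predecessor on the leg.\<close>
  define r where "r x = (if x = v then 0 else Suc (LEAST i. \<exists>p\<in>set ps. i < length p \<and> p ! i = x))" for x
  have r_leg: "r (p ! i) = Suc i" if p: "p \<in> set ps" and i: "i < length p" for p i
  proof -
    have "p ! i \<noteq> v"
      using p i dist by auto
    moreover have "j = i" if "q \<in> set ps" "j < length q" "q ! j = p ! i" for q j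
    proof -
      have "q = p"
        using distinct_concat_eq[of ps q p "p ! i"] that p i dist nth_mem[of j q] by simp
      moreover have "distinct p"
        using dist p by (simp add: distinct_concat_iff)
      ultimately show ?thesis
        using that i nth_eq_iff_index_eq by blast
    qed
    then have "(LEAST j. \<exists>q\<in>set ps. j < length q \<and> q ! j = p ! i) = i"
      using p i by (intro Least_equality) auto
    ultimately show ?thesis
      by (simp add: r_def)
  qed
  have parent: "\<exists>p i. p \<in> set ps \<and> i < length p \<and> x = p ! i \<and> y = (v # p) ! i"
    if xy: "(x, y) \<in> parcs G" "r y \<le> r x" for x y
  proof (cases "x = v")
    case True
    then have "y = v"
      using xy(2) by (simp add: r_def split: if_splits)
    then show ?thesis
      using True xy pair_no_loops by fastforce
  next
    case False
    then obtain p i where p: "p \<in> set ps" "i < length p" "x = p ! i"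
      using in_arcsD1[OF xy(1)] unfolding V by (auto simp: in_set_conv_nth)
    have "\<not> (Suc i < length p \<and> y = p ! Suc i)"
      using xy(2) r_leg[OF p(1)] p(2,3) by auto
    then show ?thesis
      using arc[OF p(1,2)] p xy(1) by blast
  qed
  have "\<not> (\<exists>p. cycle p \<and> 3 \<le> length p)"
  proof (rule acyclic_if_rank)
    fix x y z assume "(y, x) \<in> parcs G" "(x, z) \<in> parcs G" "r y \<le> r x" "r z \<le> r x"
    then obtain p i q j where p: "p \<in> set ps" "i < length p" "x = p ! i" "y = (v # p) ! i"
      and q: "q \<in> set ps" "j < length q" "x = q ! j" "z = (v # q) ! j"
      using parent arcs_symmetric by meson
    have "i = j"
      using r_leg[OF p(1,2)] r_leg[OF q(1,2)] p(3) q(3) by simp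
    moreover have "x \<in> set p" "x \<in> set q"
      using p(2,3) q(2,3) nth_mem by metis+
    then have "p = q"
      using distinct_concat_eq[of ps p q x] p(1) q(1) dist by simp
    ultimately show "y = z"
      using p(4) q(4) by simp
  qed
  then show ?thesis
    using conn pair_graph_axioms by (simp add: simple_graph_tree_def)
qed

section \<open>Balanced starlike trees\<close>

text \<open>Sorting the legs by length turns equality of multisets into equality position by
  position.\<close>

lemma sort_key_length_eq:
  fixes ps :: "'c list list" and qs :: "'d list list"
  assumes "mset (map length ps) = mset (map length qs)"
  shows "map length (sort_key length ps) = map length (sort_key length qs)"
proof -
  have "sort (map length xs) = map length (sort_key length xs)" for xs :: "'c list list"
    by (rule properties_for_sort) simp_all
  moreover have "sort (map length xs) = map length (sort_key length xs)" for xs :: "'d list list"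
    by (rule properties_for_sort) simp_all
  moreover have "sort (map length ps) = sort (map length qs)"
    using assms by (intro properties_for_sort) simp_all
  ultimately show ?thesis
    by simp
qed

lemma starlike_sort_key:
  assumes "starlike G v ps"
  shows "starlike G v (sort_key f ps)"
proof -
  have "mset (concat (sort_key f ps)) = mset (concat ps)"
    unfolding mset_concat by (metis mset_map mset_sort sum_mset_sum_list)
  then have "distinct (concat (sort_key f ps)) = distinct (concat ps)"
    by (rule mset_eq_imp_distinct_iff)
  then show ?thesis
    using assms by (simp add: starlike_def)
qed

lemma distinct_lists_bijection:
  assumes "distinct xs" "distinct ys" "length xs = length ys"
  obtains f where "inj_on f (set xs)" "map f xs = ys"
proof -
  define f where "f x = the (map_of (zip xs ys) x)" for x
  have "map f xs = ys"
    using assms by (intro nth_equalityI) (simp_all add: f_def map_of_zip_nth)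
  moreover have "inj_on f (set xs)"
    using calculation assms(2) by (metis distinct_map)
  ultimately show ?thesis
    using that by blast
qed

lemma concat_eq_same_lengths:
  assumes "map length ps = map length qs" "concat ps = concat qs"
  shows "ps = qs"
  using assms
proof (induction ps arbitrary: qs)
  case (Cons p ps)
  then obtain q qs' where "qs = q # qs'"
    by (cases qs) auto
  with Cons show ?case
    by auto
qed simp

lemma vwalk_arcs_map: "vwalk_arcs (map f p) = map (map_prod f f) (vwalk_arcs p)"
  by (induction p rule: vwalk_arcs.induct) simp_all

lemma symcl_image: "map_prod f f ` (R\<^sup>s) = (map_prod f f ` R)\<^sup>s"
  by (simp add: symcl_def image_Un image_image map_prod_def case_prod_beta)

text \<open>After sorting, the vertices are matched along the concatenated legs. Equal lengths make
  this matching send leg to leg, and hence arcs to arcs.\<close>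

lemma digraph_iso_if_starlike:
  assumes "starlike G v ps" "starlike H w qs" "mset (map length ps) = mset (map length qs)"
  shows "digraph_iso (with_proj G) (with_proj H)"
proof -
  define ps' qs' where "ps' = sort_key length ps" and "qs' = sort_key length qs"
  have G: "starlike G v ps'" and H: "starlike H w qs'"
    unfolding ps'_def qs'_def by (rule starlike_sort_key, fact)+
  have len: "map length ps' = map length qs'"
    unfolding ps'_def qs'_def by (rule sort_key_length_eq[OF assms(3)])
  have "length (v # concat ps') = length (w # concat qs')"
    using len by (simp add: length_concat)
  then obtain f where f: "inj_on f (set (v # concat ps'))" "map f (v # concat ps') = w # concat qs'"
    using distinct_lists_bijection G H unfolding starlike_def by metis
  have "concat (map (map f) ps') = concat qs'"
    using f(2) by (simp add: map_concat)
  then have qs: "map (map f) ps' = qs'"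
    using len by (intro concat_eq_same_lengths) (simp_all add: o_def)
  interpret pair_graph G
    by (rule pair_graph_if_starlike[OF assms(1)])
  have V: "pverts G = set (v # concat ps')" "pverts H = set (w # concat qs')"
    using G H by (simp_all add: starlike_def)
  have verts: "pverts H = f ` pverts G"
    unfolding V f(2)[symmetric] by (rule set_map)
  have "map_prod f f ` parcs G = (\<Union>p\<in>set ps'. (map_prod f f ` set (vwalk_arcs (v # p)))\<^sup>s)"
    using G by (simp only: starlike_def image_UN symcl_image)
  also have "\<dots> = (\<Union>p\<in>set ps'. (set (vwalk_arcs (map f (v # p))))\<^sup>s)"
    by (simp only: vwalk_arcs_map set_map)
  also have "\<dots> = (\<Union>q\<in>set qs'. (set (vwalk_arcs (w # q)))\<^sup>s)"
    using f(2) by (simp add: qs[symmetric])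
  also have "\<dots> = parcs H"
    using H by (simp add: starlike_def)
  finally have arcs: "parcs H = map_prod f f ` parcs G" ..
  let ?h = "\<lparr>iso_verts = f, iso_arcs = map_prod f f, iso_head = snd, iso_tail = fst\<rparr>"
  have inj: "inj_on f (pverts G)"
    using f(1) V(1) by simp
  have "parcs G \<subseteq> pverts G \<times> pverts G"
    using in_arcsD1 in_arcsD2 by auto
  then have "inj_on (map_prod f f) (parcs G)"
    using inj map_prod_inj_on inj_on_subset by metis
  then have "digraph_isomorphism ?h"
    using inj wf_digraph_axioms unfolding digraph_isomorphism_def by simp
  moreover have "with_proj H = app_iso ?h (with_proj G)"
    unfolding app_iso_def using verts arcs by (simp add: with_proj_def)
  ultimately show ?thesis
    unfolding digraph_iso_def by blast
qed

section \<open>Existence and extremality of balanced starlike trees\<close>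

lemma balanced_starlike_conv:
  "balanced_starlike n k G \<longleftrightarrow> (\<exists>v ps. starlike G v ps \<and> length ps = k \<and> [] \<notin> set ps \<and>
     Suc (sum_list (map length ps)) = n \<and> balanced (map length ps))"
  unfolding balanced_starlike_def starlike_def balanced_def by auto

text \<open>\<open>F\<close> collects the vertices in use, that is, the centre and the legs chosen
  so far; the next leg is an interval above all of them.\<close>

lemma distinct_lists_exist:
  fixes F :: "nat set"
  assumes "finite F"
  shows "\<exists>ps. map length ps = bs \<and> distinct (concat ps) \<and> set (concat ps) \<inter> F = {}"
  using assms
proof (induction bs arbitrary: F)
  case (Cons b bs)
  obtain m where m: "\<And>x. x \<in> F \<Longrightarrow> x < m"
    using iffD1[OF finite_nat_set_iff_bounded Cons.prems] by blast
  obtain ps where "map length ps = bs" "distinct (concat ps)"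
      "set (concat ps) \<inter> (F \<union> {m..<m + b}) = {}"
    using Cons.IH[of "F \<union> {m..<m + b}"] Cons.prems by auto
  moreover have "{m..<m + b} \<inter> F = {}"
    using m by fastforce
  ultimately have "map length ([m..<m + b] # ps) = b # bs \<and> distinct (concat ([m..<m + b] # ps)) \<and>
      set (concat ([m..<m + b] # ps)) \<inter> F = {}"
    by (auto simp del: set_concat)
  then show ?case
    by (rule exI)
qed simp

lemma balanced_starlike_exists:
  assumes "0 < k" "k < n"
  shows "\<exists>B :: nat pair_pre_digraph. balanced_starlike n k B"
proof -
  obtain bs where bs: "balanced bs" "length bs = k" "sum_list bs = n - 1"
    using balanced_exists[OF assms(1)] by blast
  obtain ps :: "nat list list" where ps: "map length ps = bs" "distinct (concat ps)" "set (concat ps) \<inter> {0} = {}"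
    using distinct_lists_exist[of "{0}" bs] by auto
  let ?B = "\<lparr>pverts = set (0 # concat ps), parcs = (\<Union>p \<in> set ps. (set (vwalk_arcs (0 # p)))\<^sup>s)\<rparr>"
  have "starlike ?B 0 ps"
    using ps(2,3) by (auto simp: starlike_def)
  \<comment> \<open>By \<open>k < n\<close> there is at least one vertex per leg, and then a
    balanced list has no entry 0.\<close>
  moreover have "[] \<notin> set ps"
    using balanced_pos[OF bs(1), of 0] bs(2,3) assms ps(1) by force
  moreover have "length ps = k"
    using arg_cong[OF ps(1), of length] bs(2) by simp
  moreover have "Suc (sum_list (map length ps)) = n"
    unfolding ps(1) bs(3) using assms by simp
  moreover have "balanced (map length ps)"
    unfolding ps(1) by (rule bs(1))
  ultimately have "balanced_starlike n k ?B"
    unfolding balanced_starlike_conv by blast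
  then show ?thesis
    by blast
qed

lemma graph_treeI:
  assumes "simple_graph_tree G"
  shows "graph_tree G"
  using assms by (simp add: graph_tree_def graph_tree_axioms_def simple_graph_tree_def)

text \<open>Existence is asserted over \<open>nat\<close>, because a finite vertex type might be too
  small; uniqueness compares trees over arbitrary vertex types up to isomorphism.\<close>

theorem theorem3p1:
  fixes n k :: nat
  assumes "3 \<le> k" and "k + 2 \<le> n"
  shows "(\<exists>B :: nat pair_pre_digraph. balanced_starlike n k B) \<and>
    (\<forall>B :: 'b pair_pre_digraph. balanced_starlike n k B \<longrightarrow>
       simple_graph_tree B \<and> card (pverts B) = n \<and> card (pendent_vertices B) = k \<and>
       (\<forall>G :: 'a pair_pre_digraph.
          simple_graph_tree G \<and> card (pverts G) = n \<and> card (pendent_vertices G) = k \<longrightarrow>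
            harary_index G \<le> harary_index B \<and>
            (harary_index G = harary_index B \<longrightarrow> digraph_iso (with_proj G) (with_proj B))))"
proof (rule conjI)
  show "\<exists>B :: nat pair_pre_digraph. balanced_starlike n k B"
    using assms by (intro balanced_starlike_exists) auto
next
  show "\<forall>B :: 'b pair_pre_digraph. balanced_starlike n k B \<longrightarrow>
       simple_graph_tree B \<and> card (pverts B) = n \<and> card (pendent_vertices B) = k \<and>
       (\<forall>G :: 'a pair_pre_digraph.
          simple_graph_tree G \<and> card (pverts G) = n \<and> card (pendent_vertices G) = k \<longrightarrow>
            harary_index G \<le> harary_index B \<and>
            (harary_index G = harary_index B \<longrightarrow> digraph_iso (with_proj G) (with_proj B)))"
  proof (intro allI impI)
    fix B :: "'b pair_pre_digraph"
    assume "balanced_starlike n k B"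
    then obtain v ps where B: "starlike B v ps" "length ps = k" "[] \<notin> set ps"
      "Suc (sum_list (map length ps)) = n" "balanced (map length ps)"
      unfolding balanced_starlike_conv by blast
    have tree_B: "simple_graph_tree B"
      by (rule simple_graph_tree_if_starlike[OF B(1)])
    interpret B: graph_tree B
      by (rule graph_treeI[OF tree_B])
    interpret TB: tree_metric "pverts B" "hops B"
      by (rule B.tree_metric_hops)
    note spider_B = B.spider_if_starlike[OF B(1)]
    have harary_B: "harary_index B = spider_harary (map length ps)"
      unfolding B.harary_index_eq by (rule harary_spider[OF B.tree_metric_hops spider_B])
    have "card (pverts B) = n"
      using TB.card_spider[OF spider_B] B(4) by simp
    moreover have "card (pendent_vertices B) = k"
      unfolding B.pendent_vertices_eq using TB.card_leaves_spider[OF spider_B B(3)] B(2) assms(1) by simp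
    moreover have "harary_index G \<le> harary_index B \<and>
        (harary_index G = harary_index B \<longrightarrow> digraph_iso (with_proj G) (with_proj B))"
      if G: "simple_graph_tree G \<and> card (pverts G) = n \<and> card (pendent_vertices G) = k"
      for G :: "'a pair_pre_digraph"
    proof -
      interpret G: graph_tree G
        by (rule graph_treeI) (use G in simp)
      interpret TG: tree_metric "pverts G" "hops G"
        by (rule G.tree_metric_hops)
      have leaves: "card (leaves (pverts G) (hops G)) = k"
        using G G.pendent_vertices_eq by simp
      have bound: "harary_index G \<le> harary_index B \<and> (harary_index G = harary_index B \<longrightarrow>
          (\<exists>u qs. spider (pverts G) (hops G) u qs \<and> [] \<notin> set qs \<and> length qs = k \<and> balanced (map length qs)))"
        using harary_le_balanced_spider[OF G.tree_metric_hops] G B assms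
        unfolding harary_B G.harary_index_eq leaves by simp
      have "digraph_iso (with_proj G) (with_proj B)" if "harary_index G = harary_index B"
      proof -
        obtain u qs where qs: "spider (pverts G) (hops G) u qs" "length qs = k" "balanced (map length qs)"
          using bound \<open>harary_index G = harary_index B\<close> by blast
        have "Suc (sum_list (map length qs)) = n"
          using TG.card_spider[OF qs(1)] G by simp
        \<comment> \<open>Balanced lists of equal length and sum agree up to order, and the multiset
          of leg lengths determines a starlike tree up to isomorphism.\<close>
        then have "mset (map length qs) = mset (map length ps)"
          using qs(2) B(2,4) by (intro balanced_mset_eq qs(3) B(5)) auto
        then show ?thesis
          by (rule digraph_iso_if_starlike[OF G.starlike_if_spider[OF qs(1)] B(1)])
      qed
      with bound show ?thesis
        by blast
    qed
    ultimately show "simple_graph_tree B \<and> card (pverts B) = n \<and> card (pendent_vertices B) = k \<and>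
       (\<forall>G :: 'a pair_pre_digraph.
          simple_graph_tree G \<and> card (pverts G) = n \<and> card (pendent_vertices G) = k \<longrightarrow>
            harary_index G \<le> harary_index B \<and>
            (harary_index G = harary_index B \<longrightarrow> digraph_iso (with_proj G) (with_proj B)))"
      using tree_B by blast
  qed
qed

end
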